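(* Let $d\ge2$, let $n_1,\ldots,n_{d-1}$ be positive integers, let $A$ be the $(d-1)\times n$ rational normal scroll matrix with $n=d-1+n_1+\cdots+n_{d-1}$, and let $c=(c_{ij})_{1\le i\le d-1,\,0\le j\le n_i}$ be a scaling vector with all $c_{ij}\in\mathbb{C}^*$. For $i=1,\ldots,d-1$ let $$g_i=c_{i0}+c_{i1}\theta_{d-1}+c_{i2}\theta_{d-1}^2+\cdots+c_{in_i}\theta_{d-1}^{n_i}.$$ Then the ML degree of the rational normal scroll $V^c\subset\mathbb{P}^{n-1}$ given by $A$ and scaled by $c$ is equal to the number of distinct (complex) roots of the univariate polynomial $g_1g_2\cdots g_{d-1}$.
   Context: Rational normal scroll matrix: the columns of $A$ are indexed by pairs $(i,j)$ with $1\le i\le d-1$, $0\le j\le n_i$. With $e_1,\ldots,e_{d-1}$ the standard basis of $\mathbb{Z}^{d-1}$, the column indexed by $(i,j)$ is $a_{ij}=e_i+j\,e_{d-1}$ for $1\le i\le d-2$, and $a_{d-1,j}=j\,e_{d-1}$. That is, $$A=\begin{pmatrix}1&\cdots&1&0&\cdots&0&\cdots&0&\cdots&0&0&\cdots&0\\0&\cdots&0&1&\cdots&1&\cdots&0&\cdots&0&0&\cdots&0\\ \vdots&&&&&&&&&&&&\vdots\\0&\cdots&0&0&\cdots&0&\cdots&1&\cdots&1&0&\cdots&0\\0&1\cdots&n_1&0&1\cdots&n_2&\cdots&0&1\cdots&n_{d-2}&0&1\cdots&n_{d-1}\end{pmatrix}.$$ Scaled toric variety: $V^c$ is the projective variety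 in $\mathbb{P}^{n-1}$ over $\mathbb{C}$ whose affine cone is the Zariski closure in $\mathbb{C}^n$ of the image of $(\mathbb{C}^* )^d\to(\mathbb{C}^* )^n$, $(s,\theta_1,\ldots,\theta_{d-1})\mapsto(c_{ij}\,s\,\theta^{a_{ij}})_{i,j}$. ML degree: for a projective variety $X\subset\mathbb{P}^{n-1}$ with homogeneous coordinates $[p_1:\cdots:p_n]$ and a vector $u=(u_1,\ldots,u_n)$, let $\ell_u(p)=p_1^{u_1}\cdots p_n^{u_n}/(p_1+\cdots+p_n)^{u_1+\cdots+u_n}$. Let $X_{\mathrm{reg}}$ be the set of smooth points of $X$ and let $\mathcal{H}$ be the union of the coordinate hyperplanes and the hyperplane $p_1+\cdots+p_n=0$. Then the ML degree of $X$ is the number of complex critical points of $\ell_u$ on $X_{\mathrm{reg}}\setminus\mathcal{H}$ for generic $u$ (this number is well-defined). *)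

theory Defs
  imports
    "HOL-Analysis.Analysis"
    "HOL-Library.Poly_Mapping"
    "HOL-Library.Function_Algebras"
    "HOL-Computational_Algebra.Polynomial"
begin

section \<open>Affine space and polynomial functions over a finite index set\<close>

text \<open>Vectors indexed by a finite set \<open>I\<close> are total functions vanishing outside \<open>I\<close>, so that
  equality of vectors is equality of functions and counting them is meaningful.\<close>

definition cspace :: "'a set \<Rightarrow> ('a \<Rightarrow> complex) set" where
  "cspace I = {x. \<forall>k. k \<notin> I \<longrightarrow> x k = 0}"

definition cdim :: "('a \<Rightarrow> complex) set \<Rightarrow> nat" where
  "cdim = vector_space.dim (\<lambda>(a::complex) f k. a * f k)"

lemma vector_space_cfun: "vector_space (\<lambda>(a::complex) (f::'a \<Rightarrow> complex) k. a * f k)"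
  by unfold_locales (auto simp: fun_eq_iff algebra_simps)

type_synonym 'a cpoly = "('a \<Rightarrow>\<^sub>0 nat) \<Rightarrow>\<^sub>0 complex"

text \<open>Polynomials that only involve variables from \<open>I\<close>. Without this restriction a nonzero
  polynomial could vanish identically on \<open>cspace I\<close>.\<close>

definition polys :: "'a set \<Rightarrow> 'a cpoly set" where
  "polys I = {F. \<forall>m\<in>Poly_Mapping.keys F. Poly_Mapping.keys m \<subseteq> I}"

definition peval :: "'a cpoly \<Rightarrow> ('a \<Rightarrow> complex) \<Rightarrow> complex" where
  "peval F x = (\<Sum>m\<in>Poly_Mapping.keys F. Poly_Mapping.lookup F m *
     (\<Prod>k\<in>Poly_Mapping.keys m. x k ^ Poly_Mapping.lookup m k))"

definition vanishing_ideal :: "'a set \<Rightarrow> ('a \<Rightarrow> complex) set \<Rightarrow> 'a cpoly set" where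
  "vanishing_ideal I S = {F \<in> polys I. \<forall>x\<in>S. peval F x = 0}"

definition zariski_closure :: "'a set \<Rightarrow> ('a \<Rightarrow> complex) set \<Rightarrow> ('a \<Rightarrow> complex) set" where
  "zariski_closure I S = {x \<in> cspace I. \<forall>F\<in>vanishing_ideal I S. peval F x = 0}"

section \<open>Projective space\<close>

text \<open>A point of projective space is the set of all its vectors of homogeneous coordinates.\<close>

definition proj_class :: "('a \<Rightarrow> complex) \<Rightarrow> ('a \<Rightarrow> complex) set" where
  "proj_class p = {\<lambda>k. t * p k | t. t \<noteq> 0}"

definition projectivize :: "('a \<Rightarrow> complex) set \<Rightarrow> ('a \<Rightarrow> complex) set set" where
  "projectivize C = proj_class ` (C - {\<lambda>_. 0})"

definition affine_cone :: "('a \<Rightarrow> complex) set set \<Rightarrow> ('a \<Rightarrow> complex) set" where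
  "affine_cone X = insert (\<lambda>_. 0) (\<Union>X)"

definition proj_closed :: "'a set \<Rightarrow> ('a \<Rightarrow> complex) set set \<Rightarrow> bool" where
  "proj_closed I Y \<longleftrightarrow>
     Y \<subseteq> projectivize (cspace I) \<and> zariski_closure I (affine_cone Y) = affine_cone Y"

definition proj_irreducible :: "'a set \<Rightarrow> ('a \<Rightarrow> complex) set set \<Rightarrow> bool" where
  "proj_irreducible I Y \<longleftrightarrow> proj_closed I Y \<and> Y \<noteq> {} \<and>
     (\<forall>Y1 Y2. proj_closed I Y1 \<longrightarrow> proj_closed I Y2 \<longrightarrow> Y = Y1 \<union> Y2 \<longrightarrow> Y = Y1 \<or> Y = Y2)"

section \<open>Smooth points\<close>

text \<open>The Krull dimension of the local ring of \<open>X\<close> at \<open>P\<close>: the supremum of the lengths of chains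
  of irreducible closed subsets of \<open>X\<close> through \<open>P\<close>.\<close>

definition local_dim ::
    "'a set \<Rightarrow> ('a \<Rightarrow> complex) set set \<Rightarrow> ('a \<Rightarrow> complex) set \<Rightarrow> nat" where
  "local_dim I X P = Sup {l. \<exists>Z :: nat \<Rightarrow> ('a \<Rightarrow> complex) set set.
     P \<in> Z 0 \<and> (\<forall>i\<le>l. proj_irreducible I (Z i) \<and> Z i \<subseteq> X) \<and> (\<forall>i<l. Z i \<subset> Z (Suc i))}"

text \<open>The Zariski tangent space at \<open>p\<close> of the affine cone over \<open>X\<close>: the common kernel of the
  differentials at \<open>p\<close> of all polynomials vanishing on the cone. The tangent space of \<open>X\<close> at the
  projective point \<open>P\<close> of \<open>p\<close> is its quotient by the line spanned by \<open>p\<close>; this accounts for the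
  summand 1 in the definition of a smooth point.\<close>

definition cone_tangent ::
    "'a set \<Rightarrow> ('a \<Rightarrow> complex) set set \<Rightarrow> ('a \<Rightarrow> complex) \<Rightarrow> ('a \<Rightarrow> complex) set" where
  "cone_tangent I X p = {v \<in> cspace I. \<forall>F\<in>vanishing_ideal I (affine_cone X).
     ((\<lambda>t. peval F (\<lambda>k. p k + t * v k)) has_field_derivative 0) (at 0)}"

definition smooth_points :: "'a set \<Rightarrow> ('a \<Rightarrow> complex) set set \<Rightarrow> ('a \<Rightarrow> complex) set set" where
  "smooth_points I X = {P \<in> X. \<forall>p\<in>P. cdim (cone_tangent I X p) = local_dim I X P + 1}"

section \<open>Maximum likelihood degree\<close>

definition hyperplanes :: "'a set \<Rightarrow> ('a \<Rightarrow> complex) set set" where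
  "hyperplanes I = {P \<in> projectivize (cspace I).
     \<exists>p\<in>P. (\<exists>k\<in>I. p k = 0) \<or> (\<Sum>k\<in>I. p k) = 0}"

text \<open>For complex exponents \<open>u\<close> the likelihood function
  \<open>\<ell> q = (\<Prod>k\<in>I. q k powr u k) / (\<Sum>k\<in>I. q k) powr (\<Sum>k\<in>I. u k)\<close> is multivalued off the hyperplanes.
  Near a point \<open>p\<close> its branches are holomorphic and differ by nonzero constant factors, so they
  have the same critical points. The following is the branch near \<open>p\<close> normalised to have the
  value 1 at \<open>p\<close>, i.e. the quotient of \<open>\<ell> q\<close> by \<open>\<ell> p\<close>; dividing by the coordinates of \<open>p\<close> keeps all
  arguments of \<open>powr\<close> near 1, away from the branch cut. For integral \<open>u\<close> it is
  the rational function \<open>\<ell>\<close> itself divided by the constant \<open>\<ell> p\<close>.\<close>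

definition likelihood_at ::
    "'a set \<Rightarrow> ('a \<Rightarrow> complex) \<Rightarrow> ('a \<Rightarrow> complex) \<Rightarrow> ('a \<Rightarrow> complex) \<Rightarrow> complex" where
  "likelihood_at I u p q =
     (\<Prod>k\<in>I. (q k / p k) powr u k) / ((\<Sum>k\<in>I. q k) / (\<Sum>k\<in>I. p k)) powr (\<Sum>k\<in>I. u k)"

text \<open>The likelihood function is homogeneous of degree 0, so its differential on the tangent space
  of \<open>X\<close> at a smooth point vanishes iff it vanishes on the tangent space of the cone.\<close>

definition critical_points ::
    "'a set \<Rightarrow> ('a \<Rightarrow> complex) set set \<Rightarrow> ('a \<Rightarrow> complex) \<Rightarrow> ('a \<Rightarrow> complex) set set" where
  "critical_points I X u = {P \<in> smooth_points I X - hyperplanes I. \<forall>p\<in>P. \<forall>v\<in>cone_tangent I X p.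
     ((\<lambda>t. likelihood_at I u p (\<lambda>k. p k + t * v k)) has_field_derivative 0) (at 0)}"

definition for_generic :: "'a set \<Rightarrow> (('a \<Rightarrow> complex) \<Rightarrow> bool) \<Rightarrow> bool" where
  "for_generic I Q \<longleftrightarrow> (\<exists>F\<in>polys I. F \<noteq> 0 \<and> (\<forall>u\<in>cspace I. peval F u \<noteq> 0 \<longrightarrow> Q u))"

definition ml_degree :: "'a set \<Rightarrow> ('a \<Rightarrow> complex) set set \<Rightarrow> nat" where
  "ml_degree I X = (THE N. for_generic I
     (\<lambda>u. finite (critical_points I X u) \<and> card (critical_points I X u) = N))"

section \<open>Scaled toric varieties and rational normal scrolls\<close>

text \<open>The matrix \<open>A\<close> has rows \<open>1, \<dots>, m\<close> and columns indexed by \<open>I\<close>; its entry in row \<open>r\<close> and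
  column \<open>k\<close> is \<open>A r k\<close>.\<close>

definition scaled_toric_variety ::
    "'a set \<Rightarrow> nat \<Rightarrow> (nat \<Rightarrow> 'a \<Rightarrow> int) \<Rightarrow> ('a \<Rightarrow> complex) \<Rightarrow> ('a \<Rightarrow> complex) set set" where
  "scaled_toric_variety I m A c = projectivize (zariski_closure I
     {(\<lambda>k. if k \<in> I then c k * s * (\<Prod>r=1..m. \<theta> r powi A r k) else 0) | s \<theta>.
        s \<noteq> 0 \<and> (\<forall>r\<in>{1..m}. \<theta> r \<noteq> 0)})"

definition scroll_columns :: "nat \<Rightarrow> (nat \<Rightarrow> nat) \<Rightarrow> (nat \<times> nat) set" where
  "scroll_columns d n = {(i, j). 1 \<le> i \<and> i \<le> d - 1 \<and> j \<le> n i}"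

definition scroll_matrix :: "nat \<Rightarrow> nat \<Rightarrow> nat \<times> nat \<Rightarrow> int" where
  "scroll_matrix d r = (\<lambda>(i, j). if r = d - 1 then int j else if r = i then 1 else 0)"

definition rational_normal_scroll ::
    "nat \<Rightarrow> (nat \<Rightarrow> nat) \<Rightarrow> (nat \<Rightarrow> nat \<Rightarrow> complex) \<Rightarrow> (nat \<times> nat \<Rightarrow> complex) set set" where
  "rational_normal_scroll d n c =
     scaled_toric_variety (scroll_columns d n) (d - 1) (scroll_matrix d) (\<lambda>(i, j). c i j)"

definition scroll_poly :: "(nat \<Rightarrow> nat) \<Rightarrow> (nat \<Rightarrow> nat \<Rightarrow> complex) \<Rightarrow> nat \<Rightarrow> complex poly" where
  "scroll_poly n c i = (\<Sum>j=0..n i. monom (c i j) j)"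

end

theory Submission
  imports Defs "HOL-Computational_Algebra.Fundamental_Theorem_Algebra"
begin

text \<open>Off the coordinate hyperplanes the scroll consists of the points
  \<open>p (i, j) = c i j * l i * t ^ j\<close> with all \<open>l i\<close> and \<open>t\<close> nonzero; this follows from the binomials
  vanishing on the scroll, whose linearizations also give the tangent spaces. These points are
  smooth. In the local dimension, a chain of \<open>l + 1\<close> irreducible closed sets gives \<open>l + 1\<close>
  algebraically independent polynomial functions on the cone, and there are at most \<open>d\<close> of those
  because the cone is parametrized by \<open>d\<close> coordinates.

  At such a point the critical equations for the \<open>l i\<close> determine them up to a common factor as
  \<open>a i / g i (t)\<close>, where \<open>a i\<close> is the sum of the \<open>i\<close>-th block of \<open>u\<close>. What remains is one equation
  \<open>b = (\<Sum>i. a i * t * g i' (t) / g i (t))\<close>, where \<open>b\<close> is the sum of the \<open>j * u (i, j)\<close>. Clearing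
  denominators by the product \<open>G\<close> of the \<open>t - r\<close> over the distinct roots \<open>r\<close> of the \<open>g i\<close> gives a
  polynomial of degree \<open>deg G\<close>, which for generic \<open>u\<close> is squarefree and vanishes neither at 0 nor
  at the roots of \<open>G\<close>.\<close>

section \<open>Polynomial functions\<close>

text \<open>Two lemmas on polynomial functions do most of the work.
  \<open>chain_independent\<close>, applied to coordinate subspaces, also shows that a nonzero
  polynomial does not vanish identically; hence generic conditions can be met together and
  \<open>ml_degree\<close> is determined. \<open>algebraic_dependence\<close>, besides bounding
  chains, takes the place of a discriminant: the data with a double root are parametrized by too few
  variables and so lie in a hypersurface. The data \<open>u\<close> enter the critical equations
  only through the block sums and the weighted sum collected in \<open>L u\<close>. Since
  \<open>L\<close> is onto, genericity in \<open>u\<close> reduces to genericity in these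
  \<open>m + 1\<close> numbers, where unit vectors serve as witnesses. Functions generated by the
  rules of \<open>polyfun\<close> stand in for formal polynomials, because restriction to curves,
  substitution and differentiation become inductions over the rules.\<close>

inductive_set polyfun :: "'a set \<Rightarrow> (('a \<Rightarrow> complex) \<Rightarrow> complex) set" for I where
  const [intro]: "(\<lambda>_. a) \<in> polyfun I"
| coord [intro]: "k \<in> I \<Longrightarrow> (\<lambda>x. x k) \<in> polyfun I"
| add [intro]: "f \<in> polyfun I \<Longrightarrow> g \<in> polyfun I \<Longrightarrow> (\<lambda>x. f x + g x) \<in> polyfun I"
| mult [intro]: "f \<in> polyfun I \<Longrightarrow> g \<in> polyfun I \<Longrightarrow> (\<lambda>x. f x * g x) \<in> polyfun I"

lemma polyfun_sum [intro]:
  "(\<And>i. i \<in> A \<Longrightarrow> f i \<in> polyfun I) \<Longrightarrow> (\<lambda>x. \<Sum>i\<in>A. f i x) \<in> polyfun I"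
  by (induction A rule: infinite_finite_induct) auto

lemma polyfun_prod [intro]:
  "(\<And>i. i \<in> A \<Longrightarrow> f i \<in> polyfun I) \<Longrightarrow> (\<lambda>x. \<Prod>i\<in>A. f i x) \<in> polyfun I"
  by (induction A rule: infinite_finite_induct) auto

lemma polyfun_power [intro]: "f \<in> polyfun I \<Longrightarrow> (\<lambda>x. f x ^ e) \<in> polyfun I"
  by (induction e) auto

lemma polyfun_diff [intro]:
  assumes "f \<in> polyfun I" "g \<in> polyfun I"
  shows "(\<lambda>x. f x - g x) \<in> polyfun I"
proof -
  have "(\<lambda>x. f x + (- 1) * g x) \<in> polyfun I" by (intro polyfun.intros assms)
  then show ?thesis by simp
qed

lemma polyfun_uminus [intro]:
  assumes "f \<in> polyfun I"
  shows "(\<lambda>x. - f x) \<in> polyfun I"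
proof -
  have "(\<lambda>x. 0 - f x) \<in> polyfun I" by (intro polyfun.intros polyfun_diff assms)
  then show ?thesis by simp
qed

lemma polyfun_poly [intro]:
  assumes "f \<in> polyfun I"
  shows "(\<lambda>x. poly p (f x)) \<in> polyfun I"
  unfolding poly_altdef by (intro polyfun_sum polyfun.intros polyfun_power assms)

lemmas polyfun_intros = polyfun.intros polyfun_sum polyfun_prod polyfun_power polyfun_diff
  polyfun_uminus polyfun_poly

lemma polyfun_compose:
  assumes "f \<in> polyfun I" "\<And>k. k \<in> I \<Longrightarrow> (\<lambda>x. \<phi> x k) \<in> polyfun J"
  shows "(\<lambda>x. f (\<phi> x)) \<in> polyfun J"
  using assms by (induction rule: polyfun.induct) auto

lemma polyfun_cong:
  assumes "f \<in> polyfun I" "\<And>k. k \<in> I \<Longrightarrow> x k = y k"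
  shows "f x = f y"
  using assms by (induction rule: polyfun.induct) auto

text \<open>Reduces vanishing questions in several variables to the finiteness of the root set of a
  univariate polynomial.\<close>

lemma polyfun_curve:
  assumes "f \<in> polyfun I" "\<And>k. k \<in> I \<Longrightarrow> \<exists>p. \<forall>t. \<gamma> t k = poly p t"
  shows "\<exists>p. \<forall>t. f (\<gamma> t) = poly p t"
  using assms
proof (induction rule: polyfun.induct)
  case (const a)
  have "\<forall>t. a = poly [:a:] t" by simp
  then show ?case by blast
next
  case (add f g)
  then obtain p q where "\<forall>t. f (\<gamma> t) = poly p t" "\<forall>t. g (\<gamma> t) = poly q t" by blast
  then have "\<forall>t. f (\<gamma> t) + g (\<gamma> t) = poly (p + q) t" by simp
  then show ?case by blast
next
  case (mult f g)
  then obtain p q where "\<forall>t. f (\<gamma> t) = poly p t" "\<forall>t. g (\<gamma> t) = poly q t" by blast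
  then have "\<forall>t. f (\<gamma> t) * g (\<gamma> t) = poly (p * q) t" by simp
  then show ?case by blast
qed auto

text \<open>The order of the quantifiers is the point: one \<open>D\<close> serves all curves
  through \<open>p\<close>, so a curve inside the torus can be exchanged for the straight line that
  occurs in \<open>cone_tangent\<close>.\<close>

lemma polyfun_differential:
  assumes "f \<in> polyfun I"
  shows "\<exists>D. \<forall>\<gamma> v. (\<forall>k\<in>I. \<gamma> 0 k = p k \<and> ((\<lambda>t. \<gamma> t k) has_field_derivative v k) (at 0))
           \<longrightarrow> ((\<lambda>t. f (\<gamma> t)) has_field_derivative D v) (at 0)"
  using assms
proof (induction rule: polyfun.induct)
  case (const a)
  show ?case by (rule exI[of _ "\<lambda>_. 0"]) auto
next
  case (coord k)
  then show ?case by (intro exI[of _ "\<lambda>v. v k"]) auto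
next
  case (add f g)
  then obtain D E where
    "\<And>\<gamma> v. (\<forall>k\<in>I. \<gamma> 0 k = p k \<and> ((\<lambda>t. \<gamma> t k) has_field_derivative v k) (at 0))
           \<Longrightarrow> ((\<lambda>t. f (\<gamma> t)) has_field_derivative D v) (at 0)"
    "\<And>\<gamma> v. (\<forall>k\<in>I. \<gamma> 0 k = p k \<and> ((\<lambda>t. \<gamma> t k) has_field_derivative v k) (at 0))
           \<Longrightarrow> ((\<lambda>t. g (\<gamma> t)) has_field_derivative E v) (at 0)" by metis
  then show ?case by (intro exI[of _ "\<lambda>v. D v + E v"]) (auto intro!: derivative_intros)
next
  case (mult f g)
  then obtain D E where DE:
    "\<And>\<gamma> v. (\<forall>k\<in>I. \<gamma> 0 k = p k \<and> ((\<lambda>t. \<gamma> t k) has_field_derivative v k) (at 0))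
           \<Longrightarrow> ((\<lambda>t. f (\<gamma> t)) has_field_derivative D v) (at 0)"
    "\<And>\<gamma> v. (\<forall>k\<in>I. \<gamma> 0 k = p k \<and> ((\<lambda>t. \<gamma> t k) has_field_derivative v k) (at 0))
           \<Longrightarrow> ((\<lambda>t. g (\<gamma> t)) has_field_derivative E v) (at 0)" by metis
  show ?case
  proof (intro exI[of _ "\<lambda>v. D v * g p + E v * f p"] allI impI)
    fix \<gamma> :: "complex \<Rightarrow> 'a \<Rightarrow> complex" and v
    assume *: "\<forall>k\<in>I. \<gamma> 0 k = p k \<and> ((\<lambda>t. \<gamma> t k) has_field_derivative v k) (at 0)"
    have "f (\<gamma> 0) = f p" "g (\<gamma> 0) = g p"
      using * polyfun_cong[OF mult.hyps(1), of "\<gamma> 0" p] polyfun_cong[OF mult.hyps(2), of "\<gamma> 0" p]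
      by simp_all
    then show "((\<lambda>t. f (\<gamma> t) * g (\<gamma> t)) has_field_derivative D v * g p + E v * f p) (at 0)"
      using DERIV_mult[OF DE(1)[OF *] DE(2)[OF *]] by simp
  qed
qed

section \<open>Formal polynomials and polynomial functions\<close>

lemma peval_superset:
  assumes "finite S" "Poly_Mapping.keys F \<subseteq> S"
  shows "peval F x = (\<Sum>m\<in>S. Poly_Mapping.lookup F m *
     (\<Prod>k\<in>Poly_Mapping.keys m. x k ^ Poly_Mapping.lookup m k))"
  unfolding peval_def using assms by (intro sum.mono_neutral_left) (auto simp: in_keys_iff)

lemma peval_zero [simp]: "peval 0 x = 0"
  by (simp add: peval_def)

lemma peval_add: "peval (F + G) x = peval F x + peval G x"
proof -
  let ?S = "Poly_Mapping.keys F \<union> Poly_Mapping.keys G"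
  have "peval (F + G) x = (\<Sum>m\<in>?S. Poly_Mapping.lookup (F + G) m *
     (\<Prod>k\<in>Poly_Mapping.keys m. x k ^ Poly_Mapping.lookup m k))"
    by (rule peval_superset) (auto dest: set_mp[OF keys_add])
  then show ?thesis
    by (simp add: lookup_add ring_distribs sum.distrib peval_superset[of ?S F] peval_superset[of ?S G])
qed

lemma peval_sum: "peval (\<Sum>a\<in>A. F a) x = (\<Sum>a\<in>A. peval (F a) x)"
  by (induction A rule: infinite_finite_induct) (auto simp: peval_add)

lemma peval_single:
  "peval (Poly_Mapping.single m a) x =
     a * (\<Prod>k\<in>Poly_Mapping.keys m. x k ^ Poly_Mapping.lookup m k)"
  by (subst peval_superset[of "{m}"]) auto

lemma monomial_add:
  fixes x :: "'a \<Rightarrow> complex" and m m' :: "'a \<Rightarrow>\<^sub>0 nat"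
  shows "(\<Prod>k\<in>Poly_Mapping.keys (m + m'). x k ^ Poly_Mapping.lookup (m + m') k)
    = (\<Prod>k\<in>Poly_Mapping.keys m. x k ^ Poly_Mapping.lookup m k) *
      (\<Prod>k\<in>Poly_Mapping.keys m'. x k ^ Poly_Mapping.lookup m' k)"
proof -
  let ?S = "Poly_Mapping.keys m \<union> Poly_Mapping.keys m'"
  have *: "(\<Prod>k\<in>Poly_Mapping.keys l. x k ^ Poly_Mapping.lookup l k)
      = (\<Prod>k\<in>?S. x k ^ Poly_Mapping.lookup l k)" if "Poly_Mapping.keys l \<subseteq> ?S" for l
    using that by (intro prod.mono_neutral_left) (auto simp: in_keys_iff)
  show ?thesis
    unfolding *[OF keys_add] *[OF Un_upper1] *[OF Un_upper2]
    by (simp add: lookup_add power_add prod.distrib)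
qed

lemma polys_add: "F \<in> polys I \<Longrightarrow> G \<in> polys I \<Longrightarrow> F + G \<in> polys I"
  unfolding polys_def using keys_add[of F G] by blast

lemma polys_zero [simp]: "0 \<in> polys I"
  by (simp add: polys_def)

lemma polys_sum: "(\<And>a. a \<in> A \<Longrightarrow> F a \<in> polys I) \<Longrightarrow> (\<Sum>a\<in>A. F a) \<in> polys I"
  by (induction A rule: infinite_finite_induct) (auto simp: polys_add)

lemma polys_single: "Poly_Mapping.keys m \<subseteq> I \<Longrightarrow> Poly_Mapping.single m a \<in> polys I"
  by (auto simp: polys_def)

lemma peval_polyfun:
  assumes "F \<in> polys I"
  shows "peval F \<in> polyfun I"
  unfolding peval_def[abs_def]
  using assms by (intro polyfun_sum polyfun.mult polyfun.const polyfun_prod polyfun_power polyfun.coord)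
    (auto simp: polys_def)

lemma polyfun_imp_peval:
  assumes "f \<in> polyfun I"
  shows "\<exists>F\<in>polys I. \<forall>x. f x = peval F x"
  using assms
proof (induction rule: polyfun.induct)
  case (const a)
  show ?case by (rule bexI[of _ "Poly_Mapping.single 0 a"]) (auto simp: peval_single polys_single)
next
  case (coord k)
  then show ?case
    by (intro bexI[of _ "Poly_Mapping.single (Poly_Mapping.single k 1) 1"])
      (auto simp: peval_single polys_single)
next
  case (add f g)
  then show ?case by (metis peval_add polys_add)
next
  case (mult f g)
  then obtain F G where F: "F \<in> polys I" "\<forall>x. f x = peval F x" and G: "G \<in> polys I" "\<forall>x. g x = peval G x"
    by blast
  let ?H = "\<Sum>m\<in>Poly_Mapping.keys F. \<Sum>m'\<in>Poly_Mapping.keys G.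
    Poly_Mapping.single (m + m') (Poly_Mapping.lookup F m * Poly_Mapping.lookup G m')"
  have "?H \<in> polys I"
    using F(1) G(1) by (intro polys_sum polys_single order.trans[OF keys_add]) (auto simp: polys_def)
  moreover have "f x * g x = peval ?H x" for x
    unfolding peval_sum peval_single monomial_add F(2)[rule_format] G(2)[rule_format]
      peval_def[of F] peval_def[of G] sum_product
    by (intro sum.cong refl) (simp add: mult_ac)
  ultimately show ?case by blast
qed

section \<open>Zariski closure in terms of polynomial functions\<close>

lemma zariski_closure_iff:
  "x \<in> zariski_closure I S \<longleftrightarrow>
     x \<in> cspace I \<and> (\<forall>f\<in>polyfun I. (\<forall>y\<in>S. f y = 0) \<longrightarrow> f x = 0)"
proof safe
  fix f assume x: "x \<in> zariski_closure I S" and f: "f \<in> polyfun I" "\<forall>y\<in>S. f y = 0"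
  from polyfun_imp_peval[OF f(1)] obtain F where "F \<in> polys I" "\<forall>x. f x = peval F x" by blast
  then show "f x = 0"
    using x f(2) by (auto simp: zariski_closure_def vanishing_ideal_def)
qed (auto simp: zariski_closure_def vanishing_ideal_def peval_polyfun)

lemma zariski_closure_vanish:
  "\<lbrakk>f \<in> polyfun I; \<And>y. y \<in> S \<Longrightarrow> f y = 0; x \<in> zariski_closure I S\<rbrakk> \<Longrightarrow> f x = 0"
  by (auto simp: zariski_closure_iff)

lemma zariski_closure_superset: "S \<subseteq> cspace I \<Longrightarrow> S \<subseteq> zariski_closure I S"
  by (auto simp: zariski_closure_iff)

lemma zariski_closure_mono: "S \<subseteq> T \<Longrightarrow> zariski_closure I S \<subseteq> zariski_closure I T"
  unfolding zariski_closure_iff[abs_def] subset_iff by blast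

lemma zariski_closure_cspace: "zariski_closure I S \<subseteq> cspace I"
  by (auto simp: zariski_closure_def)

section \<open>Irreducible sets and algebraic independence\<close>

definition irreducible_set :: "'a set \<Rightarrow> ('a \<Rightarrow> complex) set \<Rightarrow> bool" where
  "irreducible_set I S \<longleftrightarrow> (\<forall>f\<in>polyfun I. \<forall>g\<in>polyfun I. (\<forall>x\<in>S. f x * g x = 0) \<longrightarrow>
     (\<forall>x\<in>S. f x = 0) \<or> (\<forall>x\<in>S. g x = 0))"

lemma irreducible_setD:
  "\<lbrakk>irreducible_set I S; f \<in> polyfun I; g \<in> polyfun I; \<And>x. x \<in> S \<Longrightarrow> f x * g x = 0\<rbrakk>
    \<Longrightarrow> (\<forall>x\<in>S. f x = 0) \<or> (\<forall>x\<in>S. g x = 0)"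
  by (auto simp: irreducible_set_def)

text \<open>If \<open>f\<close> is nonzero at \<open>x\<close> and \<open>g\<close> at
  \<open>y\<close>, their restrictions to the curve are nonzero polynomials, whose product has
  finitely many roots. The curve may leave \<open>S\<close> finitely often because a line in
  parameter space can cross the coordinate hyperplanes.\<close>

lemma irreducible_set_curves:
  assumes "\<And>x y. x \<in> S \<Longrightarrow> y \<in> S \<Longrightarrow> \<exists>\<gamma>. \<gamma> 0 = x \<and> \<gamma> 1 = y \<and> finite {t. \<gamma> t \<notin> S} \<and>
    (\<forall>k\<in>I. \<exists>p. \<forall>t. \<gamma> t k = poly p t)"
  shows "irreducible_set I S"
  unfolding irreducible_set_def
proof (intro ballI impI)
  fix f g assume fg: "f \<in> polyfun I" "g \<in> polyfun I" "\<forall>x\<in>S. f x * g x = 0"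
  show "(\<forall>x\<in>S. f x = 0) \<or> (\<forall>x\<in>S. g x = 0)"
  proof (rule ccontr)
    assume "\<not> ?thesis"
    then obtain x y where xy: "x \<in> S" "f x \<noteq> 0" "y \<in> S" "g y \<noteq> 0" by blast
    from assms[OF xy(1,3)] obtain \<gamma> where \<gamma>: "\<gamma> 0 = x" "\<gamma> 1 = y" "finite {t. \<gamma> t \<notin> S}"
      "\<forall>k\<in>I. \<exists>p. \<forall>t. \<gamma> t k = poly p t" by blast
    obtain p where p: "\<forall>t. f (\<gamma> t) = poly p t" using polyfun_curve[OF fg(1)] \<gamma>(4) by blast
    obtain q where q: "\<forall>t. g (\<gamma> t) = poly q t" using polyfun_curve[OF fg(2)] \<gamma>(4) by blast
    have "p * q \<noteq> 0" using p q \<gamma> xy by (metis no_zero_divisors poly_0)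
    then have fin: "finite {t. poly (p * q) t = 0}" by (rule poly_roots_finite)
    have "UNIV \<subseteq> {t. poly (p * q) t = 0} \<union> {t. \<gamma> t \<notin> S}"
      using fg(3) p q by auto
    then show False
      using fin \<gamma>(3) infinite_UNIV_char_0 finite_subset by blast
  qed
qed

lemma irreducible_set_closure:
  assumes "irreducible_set I S" "S \<subseteq> cspace I"
  shows "irreducible_set I (zariski_closure I S)"
  unfolding irreducible_set_def
proof (intro ballI impI)
  fix f g assume fg: "f \<in> polyfun I" "g \<in> polyfun I" and 0: "\<forall>x\<in>zariski_closure I S. f x * g x = 0"
  have "(\<forall>x\<in>S. f x = 0) \<or> (\<forall>x\<in>S. g x = 0)"
    using 0 zariski_closure_superset[OF assms(2)] by (intro irreducible_setD[OF assms(1) fg]) blast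
  then show "(\<forall>x\<in>zariski_closure I S. f x = 0) \<or> (\<forall>x\<in>zariski_closure I S. g x = 0)"
    using fg zariski_closure_vanish by blast
qed

text \<open>In a relation between the \<open>f i\<close>, the smallest power of the last \<open>f i\<close> cancels by
  irreducibility; restricting to the zeros of that \<open>f i\<close> leaves a relation between the others.\<close>

lemma chain_independent:
  fixes W :: "nat \<Rightarrow> ('a \<Rightarrow> complex) set" and e :: "'b \<Rightarrow> nat \<Rightarrow> nat" and c :: "'b \<Rightarrow> complex"
  assumes "\<And>i. i < l \<Longrightarrow> f i \<in> polyfun I"
    and "W 0 \<noteq> {}"
    and "\<And>i. i < l \<Longrightarrow> W i \<subseteq> W (Suc i)"
    and "\<And>i x. i < l \<Longrightarrow> x \<in> W i \<Longrightarrow> f i x = 0"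
    and "\<And>i. i < l \<Longrightarrow> \<exists>x\<in>W (Suc i). f i x \<noteq> 0"
    and "\<And>i. i < l \<Longrightarrow> irreducible_set I (W (Suc i))"
    and "finite M" "M \<noteq> {}" "\<And>m. m \<in> M \<Longrightarrow> c m \<noteq> 0"
    and "\<And>m m'. m \<in> M \<Longrightarrow> m' \<in> M \<Longrightarrow> (\<And>i. i < l \<Longrightarrow> e m i = e m' i) \<Longrightarrow> m = m'"
  shows "\<exists>x\<in>W l. (\<Sum>m\<in>M. c m * (\<Prod>i<l. f i x ^ e m i)) \<noteq> 0"
  using assms
proof (induction l arbitrary: M)
  case 0
  then obtain m where m: "m \<in> M" by blast
  \<comment> \<open>With no exponents left to compare, all indices in \<open>M\<close> coincide, and
    the sum is a single nonzero coefficient.\<close>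
  then have "M = {m}" using "0.prems"(10) by blast
  then show ?case using 0 by auto
next
  case (Suc l)
  define E where "E = Min ((\<lambda>m. e m l) ` M)"
  have E: "E \<le> e m l" if "m \<in> M" for m using Suc.prems(7) that by (auto simp: E_def)
  have "E \<in> (\<lambda>m. e m l) ` M" unfolding E_def using Suc.prems(7,8) by (intro Min_in) auto
  then obtain m0 where m0: "m0 \<in> M" "e m0 l = E" by auto
  define M' where "M' = {m\<in>M. e m l = E}"
  define g where "g = (\<lambda>x. \<Sum>m\<in>M. c m * ((\<Prod>i<l. f i x ^ e m i) * f l x ^ (e m l - E)))"
  have fl: "f i \<in> polyfun I" if "i < Suc l" for i using Suc.prems(1) that by auto
  have g_poly: "g \<in> polyfun I"
    unfolding g_def using fl by (intro polyfun_sum polyfun.mult polyfun.const polyfun_prod polyfun_power) auto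
  have eq: "(\<Sum>m\<in>M. c m * (\<Prod>i<Suc l. f i x ^ e m i)) = f l x ^ E * g x" for x
    unfolding g_def sum_distrib_left
  proof (intro sum.cong refl)
    fix m assume "m \<in> M"
    then have "f l x ^ e m l = f l x ^ E * f l x ^ (e m l - E)" by (simp add: E flip: power_add)
    then show "c m * (\<Prod>i<Suc l. f i x ^ e m i) =
        f l x ^ E * (c m * ((\<Prod>i<l. f i x ^ e m i) * f l x ^ (e m l - E)))"
      by (simp add: mult_ac)
  qed
  have "\<exists>x\<in>W l. (\<Sum>m\<in>M'. c m * (\<Prod>i<l. f i x ^ e m i)) \<noteq> 0"
  proof (rule Suc.IH)
    show "M' \<noteq> {}" using m0 by (auto simp: M'_def)
    show "m = m'" if "m \<in> M'" "m' \<in> M'" "\<And>i. i < l \<Longrightarrow> e m i = e m' i" for m m'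
      using that by (intro Suc.prems(10)) (auto simp: M'_def less_Suc_eq)
  qed (use Suc.prems in \<open>auto simp: M'_def\<close>)
  then obtain x where x: "x \<in> W l" "(\<Sum>m\<in>M'. c m * (\<Prod>i<l. f i x ^ e m i)) \<noteq> 0" by blast
  \<comment> \<open>Since \<open>f l\<close> vanishes at \<open>x\<close>, only the terms with
    \<open>e m l = E\<close> survive; for these the remaining power is
    \<open>0 ^ 0 = 1\<close>.\<close>
  have "g x = (\<Sum>m\<in>M'. c m * (\<Prod>i<l. f i x ^ e m i))"
    unfolding g_def M'_def sum.inter_filter[OF Suc.prems(7)]
  proof (intro sum.cong refl)
    fix m assume "m \<in> M"
    moreover have "f l x = 0" using Suc.prems(4)[OF _ x(1)] by simp
    ultimately show "c m * ((\<Prod>i<l. f i x ^ e m i) * f l x ^ (e m l - E)) =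
        (if e m l = E then c m * (\<Prod>i<l. f i x ^ e m i) else 0)"
      using E[of m] by (simp add: zero_power)
  qed
  then have gx: "g x \<noteq> 0" using x by simp
  show ?case
  proof (rule ccontr)
    assume "\<not> ?thesis"
    then have 0: "f l y ^ E * g y = 0" if "y \<in> W (Suc l)" for y using eq that by auto
    have "(\<forall>x\<in>W (Suc l). f l x ^ E = 0) \<or> (\<forall>x\<in>W (Suc l). g x = 0)"
      using Suc.prems(6)[of l] 0 by (intro irreducible_setD[of I]) (auto intro!: polyfun_power fl g_poly)
    moreover have "\<exists>x\<in>W (Suc l). f l x \<noteq> 0" using Suc.prems(5) by auto
    moreover have "x \<in> W (Suc l)" using x(1) Suc.prems(3) by auto
    ultimately show False using gx by auto
  qed
qed

section \<open>Nonvanishing of polynomials on affine space\<close>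

lemma irreducible_set_affine:
  assumes "\<And>x y t. x \<in> S \<Longrightarrow> y \<in> S \<Longrightarrow> (\<lambda>k. (1 - t) * x k + t * y k) \<in> S"
  shows "irreducible_set I S"
proof (rule irreducible_set_curves)
  fix x y assume xy: "x \<in> S" "y \<in> S"
  have "\<exists>p. \<forall>t. (1 - t) * x k + t * y k = poly p t" for k
    by (rule exI[of _ "[:x k, y k - x k:]"]) (simp add: algebra_simps)
  then show "\<exists>\<gamma>. \<gamma> 0 = x \<and> \<gamma> 1 = y \<and> finite {t. \<gamma> t \<notin> S} \<and> (\<forall>k\<in>I. \<exists>p. \<forall>t. \<gamma> t k = poly p t)"
    using assms[OF xy] by (intro exI[of _ "\<lambda>t k. (1 - t) * x k + t * y k"]) auto
qed

lemma irreducible_cspace: "irreducible_set I (cspace I)"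
  by (rule irreducible_set_affine) (auto simp: cspace_def)

text \<open>In an irreducible space finitely many nonempty open sets have a common point. This is
  what allows generic conditions to be combined.\<close>

lemma polyfun_prod_nonvanishing:
  assumes "finite A" "\<And>a. a \<in> A \<Longrightarrow> f a \<in> polyfun I" "\<And>a. a \<in> A \<Longrightarrow> \<exists>u\<in>cspace I. f a u \<noteq> 0"
  shows "\<exists>u\<in>cspace I. (\<Prod>a\<in>A. f a u) \<noteq> 0"
  using assms
proof (induction A)
  case empty
  have "(\<lambda>_. 0) \<in> cspace I" by (simp add: cspace_def)
  then show ?case by auto
next
  case (insert a A)
  show ?case
  proof (rule ccontr)
    assume "\<not> ?thesis"
    then have "f a u * (\<Prod>a\<in>A. f a u) = 0" if "u \<in> cspace I" for u
      using insert.hyps that by auto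
    then have "(\<forall>u\<in>cspace I. f a u = 0) \<or> (\<forall>u\<in>cspace I. (\<Prod>a\<in>A. f a u) = 0)"
      using insert.prems by (intro irreducible_setD[OF irreducible_cspace] polyfun_prod) auto
    then show False using insert by blast
  qed
qed

lemma peval_finite:
  assumes "finite I" "F \<in> polys I"
  shows "peval F x = (\<Sum>m\<in>Poly_Mapping.keys F. Poly_Mapping.lookup F m *
      (\<Prod>k\<in>I. x k ^ Poly_Mapping.lookup m k))"
  unfolding peval_def using assms
  by (intro sum.cong refl arg_cong2[of _ _ _ _ "(*)"] prod.mono_neutral_left)
    (auto simp: polys_def in_keys_iff)

lemma polys_lookup_eq_0: "\<lbrakk>F \<in> polys I; m \<in> Poly_Mapping.keys F; k \<notin> I\<rbrakk> \<Longrightarrow> Poly_Mapping.lookup m k = 0"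
  unfolding polys_def by (metis (no_types, lifting) in_keys_iff mem_Collect_eq subsetD)

text \<open>The coordinate flag from \<open>W 0\<close>, the origin, up to \<open>W n\<close>, the
  whole space, is a chain cut out by the coordinates, so \<open>chain_independent\<close> says that
  distinct monomials satisfy no linear relation.\<close>

lemma peval_nonvanishing:
  fixes F :: "'a cpoly"
  assumes "finite I" "F \<in> polys I" "F \<noteq> 0"
  shows "\<exists>u\<in>cspace I. peval F u \<noteq> 0"
proof -
  obtain e where e: "bij_betw e {0..<card I} I" using ex_bij_betw_nat_finite[OF assms(1)] by blast
  define n where "n = card I"
  have e: "bij_betw e {..<n} I" using e by (simp add: n_def atLeast0LessThan)
  have eI: "e i \<in> I" if "i < n" for i using e that by (auto simp: bij_betw_def)
  have e_inj: "e i = e j \<longleftrightarrow> i = j" if "i < n" "j < n" for i j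
    using e that by (auto simp: bij_betw_def inj_on_def)
  define W where "W = (\<lambda>i. {x \<in> cspace I. \<forall>j. i \<le> j \<longrightarrow> j < n \<longrightarrow> x (e j) = 0})"
  have eval: "peval F x = (\<Sum>m\<in>Poly_Mapping.keys F. Poly_Mapping.lookup F m *
      (\<Prod>i<n. x (e i) ^ Poly_Mapping.lookup m (e i)))" for x
    unfolding peval_finite[OF assms(1,2)]
    by (intro sum.cong refl arg_cong2[of _ _ _ _ "(*)"] prod.reindex_bij_betw[OF e, symmetric])
  have "\<exists>x\<in>W n. (\<Sum>m\<in>Poly_Mapping.keys F. Poly_Mapping.lookup F m *
      (\<Prod>i<n. x (e i) ^ Poly_Mapping.lookup m (e i))) \<noteq> 0"
  proof (rule chain_independent[where f = "\<lambda>i x. x (e i)" and I = I])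
    have "(\<lambda>_. 0) \<in> W 0" by (simp add: W_def cspace_def)
    then show "W 0 \<noteq> {}" by blast
    show "\<exists>x\<in>W (Suc i). x (e i) \<noteq> 0" if "i < n" for i
      using that eI e_inj
      by (intro bexI[of _ "\<lambda>k. if k = e i then 1 else 0"]) (auto simp: W_def cspace_def)
    show "irreducible_set I (W (Suc i))" for i
      by (rule irreducible_set_affine) (auto simp: W_def cspace_def)
    show "Poly_Mapping.keys F \<noteq> {}" using assms(3) by simp
    show "m = m'" if "m \<in> Poly_Mapping.keys F" "m' \<in> Poly_Mapping.keys F"
      "\<And>i. i < n \<Longrightarrow> Poly_Mapping.lookup m (e i) = Poly_Mapping.lookup m' (e i)" for m m'
    proof (rule poly_mapping_eqI)
      fix k
      show "Poly_Mapping.lookup m k = Poly_Mapping.lookup m' k"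
      proof (cases "k \<in> I")
        case True
        then obtain i where "i < n" "k = e i" using e by (auto simp: bij_betw_def)
        then show ?thesis using that(3) by simp
      next
        case False
        then show ?thesis using that(1,2) assms(2) by (simp add: polys_lookup_eq_0)
      qed
    qed
  qed (auto simp: W_def in_keys_iff intro: eI polyfun.coord)
  then show ?thesis unfolding eval by (auto simp: W_def)
qed

section \<open>Algebraic dependence by counting monomials\<close>

context
begin

interpretation cfun: vector_space "\<lambda>(a::complex) (f::'a \<Rightarrow> complex) k. a * f k"
  by (rule vector_space_cfun)

lemma sum_apply: "(\<Sum>a\<in>A. F a) x = (\<Sum>a\<in>A. F a x :: complex)"
  by (induction A rule: infinite_finite_induct) auto

text \<open>The degree is bounded in each variable separately, so the exponents fill a box and there
  are at most \<open>(D + 1) ^ card J\<close> spanning monomials.\<close>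

definition bounded_degree :: "'a set \<Rightarrow> nat \<Rightarrow> (('a \<Rightarrow> complex) \<Rightarrow> complex) set" where
  "bounded_degree J D = cfun.span ((\<lambda>m x. \<Prod>k\<in>J. x k ^ m k) ` (J \<rightarrow>\<^sub>E {..D}))"

lemma bounded_degree_mono: "D \<le> E \<Longrightarrow> f \<in> bounded_degree J D \<Longrightarrow> f \<in> bounded_degree J E"
  unfolding bounded_degree_def by (erule set_mp[OF cfun.span_mono, rotated]) (auto intro!: image_mono PiE_mono)

text \<open>Membership of the product in the target span is a linear condition on each factor, so
  two inductions over spans reduce it to products of monomials.\<close>

lemma bounded_degree_mult:
  assumes "f \<in> bounded_degree J D" "g \<in> bounded_degree J E"
  shows "(\<lambda>x. f x * g x) \<in> bounded_degree J (D + E)"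
proof -
  let ?S = "\<lambda>D. (\<lambda>m (x :: 'a \<Rightarrow> complex). \<Prod>k\<in>J. x k ^ m k) ` (J \<rightarrow>\<^sub>E {..D})"
  let ?T = "cfun.span (?S (D + E))"
  have sub: "cfun.subspace {f. (\<lambda>x. f x * h x) \<in> ?T}" for h
  proof (rule cfun.subspaceI)
    show "0 \<in> {f. (\<lambda>x. f x * h x) \<in> ?T}"
      using cfun.span_zero[of "?S (D + E)"] by (simp add: zero_fun_def)
    show "f + g \<in> {f. (\<lambda>x. f x * h x) \<in> ?T}"
      if "f \<in> {f. (\<lambda>x. f x * h x) \<in> ?T}" "g \<in> {f. (\<lambda>x. f x * h x) \<in> ?T}" for f g
      using that cfun.span_add[of "\<lambda>x. f x * h x" "?S (D + E)" "\<lambda>x. g x * h x"]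
      by (simp add: plus_fun_def ring_distribs)
    show "(\<lambda>x. a * f x) \<in> {f. (\<lambda>x. f x * h x) \<in> ?T}" if "f \<in> {f. (\<lambda>x. f x * h x) \<in> ?T}" for a f
      using that cfun.span_scale[of "\<lambda>x. f x * h x" "?S (D + E)" a] by (simp add: mult.assoc)
  qed
  have mono: "(\<lambda>x. f x * g x) \<in> ?T" if "f \<in> ?S D" "g \<in> ?S E" for f g
  proof -
    from that obtain m l where ml: "m \<in> J \<rightarrow>\<^sub>E {..D}" "l \<in> J \<rightarrow>\<^sub>E {..E}"
      and f: "f = (\<lambda>x. \<Prod>k\<in>J. x k ^ m k)" and g: "g = (\<lambda>x. \<Prod>k\<in>J. x k ^ l k)" by blast
    have "(\<lambda>x. f x * g x) = (\<lambda>x. \<Prod>k\<in>J. x k ^ restrict (\<lambda>k. m k + l k) J k)"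
      unfolding f g by (auto simp: power_add prod.distrib)
    moreover have "restrict (\<lambda>k. m k + l k) J \<in> J \<rightarrow>\<^sub>E {..D + E}"
      using ml by (auto intro!: add_mono)
    ultimately show ?thesis by (intro cfun.span_base) blast
  qed
  have 1: "(\<lambda>x. f x * g x) \<in> ?T" if "g \<in> ?S E" for g
    using assms(1)[unfolded bounded_degree_def] sub[of g]
  proof (rule cfun.span_induct[where P = "\<lambda>f. (\<lambda>x. f x * g x) \<in> ?T"])
  qed (rule mono[OF _ that])
  have "(\<lambda>x. g x * f x) \<in> ?T"
    using assms(2)[unfolded bounded_degree_def] sub[of f]
  proof (rule cfun.span_induct[where P = "\<lambda>g. (\<lambda>x. g x * f x) \<in> ?T"])
  qed (use 1 in \<open>simp add: mult.commute\<close>)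
  then show ?thesis by (simp add: bounded_degree_def mult.commute)
qed

lemma bounded_degree_const: "(\<lambda>_. a) \<in> bounded_degree J D"
proof -
  have "(\<lambda>x. \<Prod>k\<in>J. x k ^ restrict (\<lambda>_. 0) J k) \<in> bounded_degree J D"
    unfolding bounded_degree_def by (intro cfun.span_base imageI) auto
  then have "(\<lambda>_. 1) \<in> bounded_degree J D" by simp
  from cfun.span_scale[OF this[unfolded bounded_degree_def], of a]
  show ?thesis by (simp add: bounded_degree_def)
qed

lemma polyfun_bounded_degree:
  assumes "f \<in> polyfun J" "finite J"
  shows "\<exists>D. f \<in> bounded_degree J D"
  using assms(1)
proof (induction rule: polyfun.induct)
  case (const a)
  then show ?case using bounded_degree_const by blast
next
  case (coord k)
  have "(\<lambda>x. \<Prod>j\<in>J. x j ^ restrict (\<lambda>j. if j = k then 1 else 0) J j) \<in> bounded_degree J 1"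
    unfolding bounded_degree_def by (intro cfun.span_base imageI) auto
  moreover have "(\<Prod>j\<in>J. x j ^ restrict (\<lambda>j. if j = k then 1 else 0) J j) = x k"
    for x :: "'a \<Rightarrow> complex"
  proof -
    have "(\<Prod>j\<in>J. x j ^ restrict (\<lambda>j. if j = k then 1 else 0) J j) = (\<Prod>j\<in>J. if j = k then x j else 1)"
      by (intro prod.cong) auto
    then show ?thesis using coord assms(2) by (simp add: prod.delta)
  qed
  ultimately show ?case by auto
next
  case (add f g)
  then obtain D E where "f \<in> bounded_degree J D" "g \<in> bounded_degree J E" by blast
  then have "f \<in> bounded_degree J (max D E)" "g \<in> bounded_degree J (max D E)"
    by (auto intro: bounded_degree_mono[rotated])
  then have "f + g \<in> bounded_degree J (max D E)"
    unfolding bounded_degree_def by (rule cfun.span_add)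
  then show ?case unfolding plus_fun_def by blast
next
  case (mult f g)
  then show ?case using bounded_degree_mult by blast
qed

lemma bounded_degree_power:
  "f \<in> bounded_degree J D \<Longrightarrow> (\<lambda>x. f x ^ e) \<in> bounded_degree J (e * D)"
  by (induction e) (auto simp: bounded_degree_const bounded_degree_mult)

lemma bounded_degree_prod:
  assumes "finite K" "\<And>i. i \<in> K \<Longrightarrow> f i \<in> bounded_degree J D"
  shows "(\<lambda>x. \<Prod>i\<in>K. f i x) \<in> bounded_degree J (card K * D)"
  using assms by (induction K) (auto simp: bounded_degree_const bounded_degree_mult)

text \<open>There are more monomials in the \<open>f i\<close> with all exponents below \<open>k\<close> than monomials in the
  variables that can occur in them, once \<open>k\<close> is large.\<close>

lemma algebraic_dependence:
  assumes J: "finite J" and K: "finite K" and JK: "card J < card K"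
    and f: "\<And>i. i \<in> K \<Longrightarrow> f i \<in> polyfun J"
  shows "\<exists>F\<in>polys K. F \<noteq> 0 \<and> (\<forall>x. peval F (\<lambda>i. f i x) = 0)"
proof -
  have "\<forall>i\<in>K. \<exists>D. f i \<in> bounded_degree J D" using f J polyfun_bounded_degree by blast
  then obtain D' where D': "\<And>i. i \<in> K \<Longrightarrow> f i \<in> bounded_degree J (D' i)" by metis
  define D where "D = (\<Sum>i\<in>K. D' i)"
  have D: "f i \<in> bounded_degree J D" if "i \<in> K" for i
    using bounded_degree_mono[OF _ D'[OF that]] K that by (auto simp: D_def intro: member_le_sum)
  define N where "N = card J"
  \<comment> \<open>There are at least \<open>k ^ (N + 1)\<close> monomials in the
    \<open>f i\<close>, but at most \<open>k ^ N * (card K * D + 1) ^ N\<close> monomials in the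
    variables; \<open>k\<close> is chosen to exceed the last factor.\<close>
  define k where "k = Suc ((card K * D + 1) ^ N)"
  define B where "B = card K * (k * D)"
  define T where "T = (\<lambda>m (x :: 'a \<Rightarrow> complex). \<Prod>k\<in>J. x k ^ m k) ` (J \<rightarrow>\<^sub>E {..B})"
  define M where "M = K \<rightarrow>\<^sub>E {..<k}"
  define h where "h = (\<lambda>m x. \<Prod>i\<in>K. f i x ^ m i)"
  have finM: "finite M" unfolding M_def using K by (intro finite_PiE) auto
  have finT: "finite T" unfolding T_def using J by (intro finite_imageI finite_PiE) auto
  have "card T \<le> card (J \<rightarrow>\<^sub>E {..B})" unfolding T_def using J by (intro card_image_le finite_PiE) auto
  also have "\<dots> = (B + 1) ^ N" using J by (simp add: card_PiE N_def)
  also have "\<dots> \<le> (k * (card K * D + 1)) ^ N"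
    by (intro power_mono) (auto simp: B_def algebra_simps k_def)
  also have "\<dots> = k ^ N * (card K * D + 1) ^ N" by (rule power_mult_distrib)
  also have "\<dots> < k ^ N * k" by (intro mult_strict_left_mono) (auto simp: k_def)
  also have "\<dots> = k ^ Suc N" by simp
  also have "\<dots> \<le> k ^ card K" using JK by (intro power_increasing) (auto simp: N_def k_def)
  also have "\<dots> = card M" using K by (simp add: card_PiE M_def)
  finally have card: "card T < card M" .
  have hT: "h m \<in> cfun.span T" if "m \<in> M" for m
  proof -
    have "(\<lambda>x. f i x ^ m i) \<in> bounded_degree J (k * D)" if "i \<in> K" for i
    proof (rule bounded_degree_mono[OF _ bounded_degree_power[OF D[OF that]]])
      have "m i < k" using \<open>m \<in> M\<close> that by (auto simp: M_def)
      then show "m i * D \<le> k * D" by simp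
    qed
    then have "h m \<in> bounded_degree J (card K * (k * D))"
      unfolding h_def by (intro bounded_degree_prod K)
    then show ?thesis by (simp add: bounded_degree_def T_def B_def)
  qed
  have "\<exists>b. (\<exists>m\<in>M. b m \<noteq> 0) \<and> (\<forall>x. (\<Sum>m\<in>M. b m * h m x) = 0)"
  \<comment> \<open>Linear dependence concerns the image of \<open>M\<close> under \<open>h\<close>
    as a set. If two exponent vectors give the same function, their difference is already a
    relation.\<close>
  proof (cases "inj_on h M")
    case True
    have "cfun.dependent (h ` M)"
    proof (rule ccontr)
      assume "\<not> cfun.dependent (h ` M)"
      then have "card (h ` M) \<le> card T"
        using cfun.independent_span_bound[OF finT] hT by blast
      then show False using card card_image[OF True] by simp
    qed
    then obtain u v where u: "v \<in> h ` M" "u v \<noteq> 0" "(\<Sum>v\<in>h ` M. (\<lambda>x. u v * v x)) = 0"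
      unfolding cfun.dependent_finite[OF finite_imageI[OF finM]] by blast
    have "(\<Sum>m\<in>M. u (h m) * h m x) = 0" for x
    proof -
      have "(\<Sum>m\<in>M. u (h m) * h m x) = (\<Sum>m\<in>M. (\<lambda>x. u (h m) * h m x)) x"
        by (simp add: sum_apply)
      also have "\<dots> = (\<Sum>v\<in>h ` M. (\<lambda>x. u v * v x)) x" by (simp add: sum.reindex[OF True])
      finally show ?thesis using u(3) by simp
    qed
    then show ?thesis using u(1,2) by (intro exI[of _ "\<lambda>m. u (h m)"]) auto
  next
    case False
    then obtain m m' where m: "m \<in> M" "m' \<in> M" "m \<noteq> m'" "h m = h m'" by (auto simp: inj_on_def)
    define b :: "_ \<Rightarrow> complex" where "b = (\<lambda>l. if l = m then 1 else if l = m' then - 1 else 0)"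
    have "(\<Sum>l\<in>M. b l * h l x) = 0" for x
    proof -
      have "(\<Sum>l\<in>M. b l * h l x) = (\<Sum>l\<in>{m, m'}. b l * h l x)"
        using m finM by (intro sum.mono_neutral_right) (auto simp: b_def)
      then show ?thesis using m by (simp add: b_def)
    qed
    moreover have "b m \<noteq> 0" by (simp add: b_def)
    ultimately show ?thesis using m by blast
  qed
  then obtain b m0 where b: "m0 \<in> M" "b m0 \<noteq> 0" "\<And>x. (\<Sum>m\<in>M. b m * h m x) = 0" by blast
  define pm where "pm = (\<lambda>m :: 'b \<Rightarrow> nat. \<Sum>i\<in>K. Poly_Mapping.single i (m i))"
  have lookup_pm: "Poly_Mapping.lookup (pm m) i = (if i \<in> K then m i else 0)" for m i
    unfolding pm_def lookup_sum using K by (simp add: lookup_single when_def sum.delta)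
  have keys_pm: "Poly_Mapping.keys (pm m) \<subseteq> K" for m
    by (auto simp: in_keys_iff lookup_pm split: if_splits)
  have inj_pm: "m = m'" if "pm m = pm m'" "m \<in> M" "m' \<in> M" for m m'
  proof (rule PiE_ext[of m K "\<lambda>_. {..<k}" m'])
    fix i assume "i \<in> K"
    then show "m i = m' i" using lookup_pm[of m i] lookup_pm[of m' i] that(1) by simp
  qed (use that in \<open>auto simp: M_def\<close>)
  define F where "F = (\<Sum>m\<in>M. Poly_Mapping.single (pm m) (b m))"
  have "Poly_Mapping.lookup F (pm m0) = (\<Sum>m\<in>M. if m = m0 then b m else 0)"
    unfolding F_def lookup_sum lookup_single
    using inj_pm b(1) by (intro sum.cong) (auto simp: when_def)
  then have "Poly_Mapping.lookup F (pm m0) \<noteq> 0" using b finM by simp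
  then have "F \<noteq> 0" by auto
  moreover have "F \<in> polys K" unfolding F_def by (intro polys_sum polys_single keys_pm)
  moreover have "peval F (\<lambda>i. f i x) = 0" for x
  proof -
    have "(\<Prod>i\<in>Poly_Mapping.keys (pm m). f i x ^ Poly_Mapping.lookup (pm m) i) = h m x" for m
    proof -
      have "(\<Prod>i\<in>Poly_Mapping.keys (pm m). f i x ^ Poly_Mapping.lookup (pm m) i) =
        (\<Prod>i\<in>K. f i x ^ Poly_Mapping.lookup (pm m) i)"
        using keys_pm K by (intro prod.mono_neutral_left) (auto simp: in_keys_iff)
      then show ?thesis by (simp add: h_def lookup_pm)
    qed
    then show ?thesis by (simp add: F_def peval_sum peval_single b(3))
  qed
  ultimately show ?thesis by blast
qed

end

section \<open>Projective closed sets and local dimension\<close>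

definition conical :: "('a \<Rightarrow> complex) set \<Rightarrow> bool" where
  "conical S \<longleftrightarrow> (\<forall>x\<in>S. \<forall>t. t \<noteq> 0 \<longrightarrow> (\<lambda>k. t * x k) \<in> S)"

lemma conicalD: "conical S \<Longrightarrow> x \<in> S \<Longrightarrow> t \<noteq> 0 \<Longrightarrow> (\<lambda>k. t * x k) \<in> S"
  by (auto simp: conical_def)

lemma proj_class_iff: "q \<in> proj_class p \<longleftrightarrow> (\<exists>t. t \<noteq> 0 \<and> q = (\<lambda>k. t * p k))"
  unfolding proj_class_def by blast

lemma proj_class_self: "p \<in> proj_class p"
  unfolding proj_class_iff by (rule exI[of _ 1]) simp

lemma proj_class_scale:
  assumes "t \<noteq> 0"
  shows "proj_class (\<lambda>k. t * p k) = proj_class p"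
proof (intro equalityI subsetI)
  fix q assume "q \<in> proj_class (\<lambda>k. t * p k)"
  then obtain s where "s \<noteq> 0" "q = (\<lambda>k. s * (t * p k))" unfolding proj_class_iff by blast
  then show "q \<in> proj_class p"
    unfolding proj_class_iff using assms by (intro exI[of _ "s * t"]) (simp add: mult.assoc)
next
  fix q assume "q \<in> proj_class p"
  then obtain s where "s \<noteq> 0" "q = (\<lambda>k. s * p k)" unfolding proj_class_iff by blast
  then show "q \<in> proj_class (\<lambda>k. t * p k)"
    unfolding proj_class_iff using assms by (intro exI[of _ "s / t"]) simp
qed

lemma proj_class_eq: "q \<in> proj_class p \<Longrightarrow> proj_class q = proj_class p"
  unfolding proj_class_iff using proj_class_scale by blast

lemma proj_class_in_projectivize:
  assumes "conical C"
  shows "proj_class x \<in> projectivize C \<longleftrightarrow> x \<in> C \<and> x \<noteq> (\<lambda>_. 0)"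
proof
  assume "proj_class x \<in> projectivize C"
  then obtain p where p: "proj_class x = proj_class p" "p \<in> C" "p \<noteq> (\<lambda>_. 0)"
    by (auto simp: projectivize_def)
  from p(1) have "x \<in> proj_class p" using proj_class_self by metis
  then obtain t where "x = (\<lambda>k. t * p k)" "t \<noteq> 0" by (auto simp: proj_class_def)
  moreover have "\<exists>k. p k \<noteq> 0" using p(3) by (auto simp: fun_eq_iff)
  ultimately show "x \<in> C \<and> x \<noteq> (\<lambda>_. 0)"
    using conicalD[OF assms p(2)] by (auto dest: fun_cong)
qed (auto simp: projectivize_def)

lemma conical_cspace: "conical (cspace I)"
  by (auto simp: conical_def cspace_def)

lemma affine_cone_projectivize:
  assumes "conical C"
  shows "affine_cone (projectivize C) = insert (\<lambda>_. 0) C"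
proof -
  have "x \<in> \<Union> (projectivize C) \<longleftrightarrow> x \<in> C \<and> x \<noteq> (\<lambda>_. 0)" for x
  proof
    assume "x \<in> \<Union> (projectivize C)"
    then obtain p where "proj_class p \<in> projectivize C" "x \<in> proj_class p"
      by (auto simp: projectivize_def)
    then show "x \<in> C \<and> x \<noteq> (\<lambda>_. 0)"
      using proj_class_in_projectivize[OF assms, of x] proj_class_eq by metis
  next
    assume "x \<in> C \<and> x \<noteq> (\<lambda>_. 0)"
    then show "x \<in> \<Union> (projectivize C)"
      using proj_class_in_projectivize[OF assms] proj_class_self by blast
  qed
  then show ?thesis by (auto simp: affine_cone_def)
qed

lemma proj_closed_memD:
  assumes "proj_closed I Z" "P \<in> Z" "p \<in> P"
  shows "P = proj_class p" "p \<in> cspace I" "p \<noteq> (\<lambda>_. 0)"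
proof -
  have P: "P \<in> projectivize (cspace I)" using assms(1,2) by (auto simp: proj_closed_def)
  then obtain q where "P = proj_class q" by (auto simp: projectivize_def)
  then show *: "P = proj_class p" using assms(3) proj_class_eq by blast
  from P[unfolded *] show "p \<in> cspace I" "p \<noteq> (\<lambda>_. 0)"
    by (simp_all add: proj_class_in_projectivize conical_cspace)
qed

lemma proj_closed_cone_iff:
  assumes "proj_closed I Z"
  shows "x \<in> affine_cone Z \<longleftrightarrow> x = (\<lambda>_. 0) \<or> proj_class x \<in> Z"
  using proj_closed_memD(1)[OF assms] proj_class_self by (fastforce simp: affine_cone_def)

lemma polyfun_scale:
  assumes "f \<in> polyfun I"
  shows "(\<lambda>x. f (\<lambda>k. t * x k)) \<in> polyfun I"
  by (rule polyfun_compose[OF assms]) (intro polyfun_intros)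

lemma polyfun_line:
  assumes "f \<in> polyfun I"
  shows "\<exists>p. \<forall>t. f (\<lambda>k. t * x k) = poly p t"
proof (rule polyfun_curve[OF assms])
  fix k
  have "\<forall>t. t * x k = poly [:0, x k:] t" by simp
  then show "\<exists>p. \<forall>t. t * x k = poly p t" by blast
qed

lemma poly_zero_off_0:
  assumes "\<And>t :: complex. t \<noteq> 0 \<Longrightarrow> poly p t = 0"
  shows "p = 0"
proof (rule ccontr)
  assume "p \<noteq> 0"
  then have "finite {t. poly p t = 0}" by (rule poly_roots_finite)
  moreover have "UNIV \<subseteq> insert 0 {t. poly p t = 0}" using assms by auto
  ultimately show False using infinite_UNIV_char_0 finite_subset by blast
qed

text \<open>Needed because \<open>affine_cone\<close> always contains the origin while the sets it
  is formed from consist of punctured lines.\<close>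

lemma polyfun_vanish_at_0:
  assumes "f \<in> polyfun I" "\<And>t. t \<noteq> 0 \<Longrightarrow> f (\<lambda>k. t * x k) = 0"
  shows "f (\<lambda>_. 0) = 0"
proof -
  obtain p where p: "\<forall>t. f (\<lambda>k. t * x k) = poly p t" using polyfun_line[OF assms(1)] by blast
  then have "p = 0" using assms(2) by (intro poly_zero_off_0) auto
  then show ?thesis using p[rule_format, of 0] by simp
qed

lemma conical_closure:
  assumes "conical S"
  shows "conical (zariski_closure I S)"
  unfolding conical_def
proof (intro ballI allI impI)
  fix x and t :: complex assume x: "x \<in> zariski_closure I S" and t: "t \<noteq> 0"
  show "(\<lambda>k. t * x k) \<in> zariski_closure I S"
    unfolding zariski_closure_iff
  proof (intro conjI ballI impI)
    show "(\<lambda>k. t * x k) \<in> cspace I" using x by (auto simp: zariski_closure_def cspace_def)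
    fix f assume f: "f \<in> polyfun I" "\<forall>y\<in>S. f y = 0"
    show "f (\<lambda>k. t * x k) = 0"
      using zariski_closure_vanish[OF polyfun_scale[OF f(1), of t] _ x] f(2) conicalD[OF assms _ t]
      by blast
  qed
qed

lemma zero_in_closure:
  assumes "conical S" "S \<noteq> {}"
  shows "(\<lambda>_. 0) \<in> zariski_closure I S"
  unfolding zariski_closure_iff
proof (intro conjI ballI impI)
  fix f assume f: "f \<in> polyfun I" "\<forall>y\<in>S. f y = 0"
  obtain x where "x \<in> S" using assms(2) by blast
  then show "f (\<lambda>_. 0) = 0"
    using f conicalD[OF assms(1)] by (intro polyfun_vanish_at_0[OF f(1), of x]) auto
qed (simp add: cspace_def)

lemma zariski_closure_idem: "zariski_closure I (zariski_closure I S) = zariski_closure I S"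
proof
  show "zariski_closure I (zariski_closure I S) \<subseteq> zariski_closure I S"
    unfolding zariski_closure_iff[abs_def] by (auto simp: zariski_closure_iff)
qed (rule zariski_closure_superset[OF zariski_closure_cspace])

lemma affine_cone_closure:
  assumes "conical S" "S \<noteq> {}"
  shows "affine_cone (projectivize (zariski_closure I S)) = zariski_closure I S"
  using affine_cone_projectivize[OF conical_closure[OF assms(1)]] zero_in_closure[OF assms]
  by (metis insert_absorb)

lemma proj_closed_separate:
  assumes "proj_closed I Z" "x \<in> cspace I" "x \<notin> affine_cone Z"
  shows "\<exists>f\<in>polyfun I. (\<forall>y\<in>affine_cone Z. f y = 0) \<and> f x \<noteq> 0"
proof -
  have "x \<notin> zariski_closure I (affine_cone Z)" using assms(1,3) by (simp add: proj_closed_def)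
  then show ?thesis using assms(2) by (auto simp: zariski_closure_iff)
qed

text \<open>If two closed sets covering the variety were both proper, each would admit a function
  vanishing on its cone but not on the whole cone; the product of the two would vanish everywhere,
  against primality.\<close>

lemma proj_irreducible_closure:
  assumes S: "S \<subseteq> cspace I" "conical S" "irreducible_set I S" "x0 \<in> S" "x0 \<noteq> (\<lambda>_. 0)"
  shows "proj_irreducible I (projectivize (zariski_closure I S))"
proof -
  let ?C = "zariski_closure I S"
  have cone: "affine_cone (projectivize ?C) = ?C" using S by (intro affine_cone_closure) auto
  have irr: "irreducible_set I ?C" using S by (intro irreducible_set_closure)
  have con: "conical ?C" by (rule conical_closure[OF S(2)])
  have closed: "proj_closed I (projectivize ?C)"
    unfolding proj_closed_def cone zariski_closure_idem
    using zariski_closure_cspace[of I S] by (auto simp: projectivize_def)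
  have "x0 \<in> ?C" using S zariski_closure_superset by blast
  then have ne: "projectivize ?C \<noteq> {}" using S(5) by (auto simp: projectivize_def)
  have "projectivize ?C = Y1 \<or> projectivize ?C = Y2"
    if Y: "proj_closed I Y1" "proj_closed I Y2" "projectivize ?C = Y1 \<union> Y2" for Y1 Y2
  proof (rule ccontr)
    have sep: "\<exists>f\<in>polyfun I. (\<forall>y\<in>affine_cone Y. f y = 0) \<and> (\<exists>x\<in>?C. f x \<noteq> 0)"
      if Y': "proj_closed I Y" "Y \<subseteq> projectivize ?C" "projectivize ?C \<noteq> Y" for Y
    proof -
      obtain P where P: "P \<in> projectivize ?C" "P \<notin> Y" using Y' by blast
      then obtain p where p: "P = proj_class p" "p \<in> ?C" "p \<noteq> (\<lambda>_. 0)" by (auto simp: projectivize_def)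
      have "p \<notin> affine_cone Y" using P(2) p(1,3) by (simp add: proj_closed_cone_iff[OF Y'(1)])
      then show ?thesis using proj_closed_separate[OF Y'(1)] p(2) zariski_closure_cspace by blast
    qed
    assume "\<not> ?thesis"
    then obtain f g where fg: "f \<in> polyfun I" "\<forall>y\<in>affine_cone Y1. f y = 0" "\<exists>x\<in>?C. f x \<noteq> 0"
       "g \<in> polyfun I" "\<forall>y\<in>affine_cone Y2. g y = 0" "\<exists>x\<in>?C. g x \<noteq> 0"
      using sep[OF Y(1)] sep[OF Y(2)] Y(3) by (metis Un_upper1 Un_upper2)
    have "f x * g x = 0" if "x \<in> ?C" for x
    proof (cases "x = (\<lambda>_. 0)")
      case True
      then show ?thesis using fg(2) by (auto simp: affine_cone_def)
    next
      case False
      then have "proj_class x \<in> Y1 \<union> Y2"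
        using that unfolding Y(3)[symmetric] by (simp add: proj_class_in_projectivize[OF con])
      then have "x \<in> affine_cone Y1 \<or> x \<in> affine_cone Y2"
        using Y(1,2) by (auto simp: proj_closed_cone_iff)
      then show ?thesis using fg by auto
    qed
    then show False using irreducible_setD[OF irr fg(1,4)] fg(3,6) by blast
  qed
  then show ?thesis unfolding proj_irreducible_def using closed ne by blast
qed

text \<open>As \<open>f\<close> need not be homogeneous, vanishing is required along the whole
  punctured line. This is the intersection, over \<open>t \<noteq> 0\<close>, of the zero sets of
  the polynomial functions obtained by composing \<open>f\<close> with scaling by
  \<open>t\<close>.\<close>

lemma proj_closed_zeros:
  assumes Z: "proj_closed I Z" and f: "f \<in> polyfun I"
  shows "proj_closed I {P \<in> Z. \<forall>p\<in>P. f p = 0}" (is "proj_closed I ?Y")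
  unfolding proj_closed_def
proof (intro conjI equalityI)
  show "?Y \<subseteq> projectivize (cspace I)" using Z by (auto simp: proj_closed_def)
  have sub: "affine_cone ?Y \<subseteq> affine_cone Z" by (auto simp: affine_cone_def)
  have "affine_cone Z \<subseteq> cspace I"
    using Z zariski_closure_cspace by (metis proj_closed_def)
  then show "affine_cone ?Y \<subseteq> zariski_closure I (affine_cone ?Y)"
    using sub by (intro zariski_closure_superset) blast
  show "zariski_closure I (affine_cone ?Y) \<subseteq> affine_cone ?Y"
  proof
    fix x assume x: "x \<in> zariski_closure I (affine_cone ?Y)"
    have "x \<in> affine_cone Z"
      using zariski_closure_mono[OF sub] x Z unfolding proj_closed_def by blast
    then consider "x = (\<lambda>_. 0)" | "x \<noteq> (\<lambda>_. 0)" "proj_class x \<in> Z"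
      using proj_closed_cone_iff[OF Z] by blast
    then show "x \<in> affine_cone ?Y"
    proof cases
      case 1
      then show ?thesis by (simp add: affine_cone_def)
    next
      case 2
      then obtain k where k: "x k \<noteq> 0" by (auto simp: fun_eq_iff)
      then have "k \<in> I" using x by (auto simp: zariski_closure_def cspace_def)
      have "f q = 0" if "q \<in> proj_class x" for q
      proof -
        from that obtain t where t: "q = (\<lambda>k. t * x k)" "t \<noteq> 0" by (auto simp: proj_class_def)
        \<comment> \<open>the factor \<open>x k\<close> is there because every affine cone contains 0, where \<open>f\<close> need not vanish\<close>
        have "x k * f (\<lambda>k. t * x k) = 0"
        proof (rule zariski_closure_vanish[OF _ _ x, of "\<lambda>x. x k * f (\<lambda>k. t * x k)"])
          show "(\<lambda>x. x k * f (\<lambda>k. t * x k)) \<in> polyfun I"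
            by (intro polyfun.mult polyfun.coord polyfun_scale f \<open>k \<in> I\<close>)
          fix y assume "y \<in> affine_cone ?Y"
          then consider "y = (\<lambda>_. 0)" | P where "P \<in> ?Y" "y \<in> P" by (auto simp: affine_cone_def)
          then show "y k * f (\<lambda>k. t * y k) = 0"
          proof cases
            case 2
            then have "P = proj_class y" using proj_closed_memD[OF Z] by blast
            then have "(\<lambda>k. t * y k) \<in> P" using t(2) by (auto simp: proj_class_def)
            then show ?thesis using 2 by auto
          qed auto
        qed
        then show ?thesis using k t by simp
      qed
      then show ?thesis using 2 proj_class_self by (auto simp: affine_cone_def)
    qed
  qed
qed

text \<open>The factors \<open>f\<close> and \<open>g\<close> need not be homogeneous, but on each line through 0 in the cone one of
  them vanishes identically.\<close>

lemma irreducible_affine_cone: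
  assumes "proj_irreducible I Z"
  shows "irreducible_set I (affine_cone Z)"
  unfolding irreducible_set_def
proof (intro ballI impI)
  have Z: "proj_closed I Z" "Z \<noteq> {}" using assms by (auto simp: proj_irreducible_def)
  fix f g assume fg: "f \<in> polyfun I" "g \<in> polyfun I" and 0: "\<forall>x\<in>affine_cone Z. f x * g x = 0"
  let ?Y = "\<lambda>h. {P \<in> Z. \<forall>p\<in>P. h p = (0 :: complex)}"
  have "P \<in> ?Y f \<union> ?Y g" if P: "P \<in> Z" for P
  proof -
    have "P \<in> projectivize (cspace I)" using Z(1) P by (auto simp: proj_closed_def)
    then obtain p where p: "P = proj_class p" by (auto simp: projectivize_def)
    obtain a where a: "\<forall>t. f (\<lambda>k. t * p k) = poly a t" using polyfun_line[OF fg(1)] by blast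
    obtain b where b: "\<forall>t. g (\<lambda>k. t * p k) = poly b t" using polyfun_line[OF fg(2)] by blast
    have "poly (a * b) t = 0" if "t \<noteq> 0" for t
    proof -
      have "(\<lambda>k. t * p k) \<in> P" using that unfolding p proj_class_iff by blast
      then have "(\<lambda>k. t * p k) \<in> affine_cone Z" using P by (auto simp: affine_cone_def)
      then have "f (\<lambda>k. t * p k) * g (\<lambda>k. t * p k) = 0" using 0 by blast
      then show ?thesis by (simp only: a b poly_mult)
    qed
    then have "a * b = 0" by (rule poly_zero_off_0)
    then have "a = 0 \<or> b = 0" by simp
    then show ?thesis using a b P by (auto simp: p proj_class_def)
  qed
  then have eq: "Z = ?Y f \<union> ?Y g" by (intro equalityI subsetI) (assumption, blast)
  have "\<And>Y1 Y2. proj_closed I Y1 \<Longrightarrow> proj_closed I Y2 \<Longrightarrow> Z = Y1 \<union> Y2 \<Longrightarrow> Z = Y1 \<or> Z = Y2"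
    using assms unfolding proj_irreducible_def by metis
  from this[OF proj_closed_zeros[OF Z(1) fg(1)] proj_closed_zeros[OF Z(1) fg(2)] eq]
  have "Z = ?Y f \<or> Z = ?Y g" .
  moreover have "\<forall>x\<in>affine_cone Z. h x = 0" if h: "h \<in> polyfun I" "Z = ?Y h" for h
  proof -
    have *: "h x = 0" if "x \<in> P" "P \<in> Z" for x P using h(2) that by blast
    obtain P where "P \<in> Z" using Z(2) by blast
    moreover obtain p where "P = proj_class p" using \<open>P \<in> Z\<close> Z(1) by (auto simp: proj_closed_def projectivize_def)
    moreover have "(\<lambda>k. t * p k) \<in> proj_class p" if "t \<noteq> 0" for t
      using that unfolding proj_class_iff by blast
    ultimately have "h (\<lambda>_. 0) = 0"
      using * by (intro polyfun_vanish_at_0[OF h(1), of p]) blast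
    then show ?thesis using * by (auto simp: affine_cone_def)
  qed
  ultimately show "(\<forall>x\<in>affine_cone Z. f x = 0) \<or> (\<forall>x\<in>affine_cone Z. g x = 0)"
    using fg by blast
qed

text \<open>A relation between the functions pulled back to the parameters holds on the image of
  \<open>\<phi>\<close>, hence on its closure and on the largest cone of the chain, which
  contradicts \<open>chain_independent\<close>.\<close>

lemma chain_length_less:
  assumes J: "finite J" and \<phi>: "\<And>k. k \<in> I \<Longrightarrow> (\<lambda>y. \<phi> y k) \<in> polyfun J"
    and X: "affine_cone X \<subseteq> zariski_closure I (range \<phi>)"
    and Z: "\<And>i. i \<le> l \<Longrightarrow> proj_irreducible I (Z i)" "\<And>i. i \<le> l \<Longrightarrow> Z i \<subseteq> X"
      "\<And>i. i < l \<Longrightarrow> Z i \<subset> Z (Suc i)"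
  shows "l < card J"
proof (rule ccontr)
  assume "\<not> l < card J"
  then have card: "card J < card {..<Suc l}" by simp
  \<comment> \<open>Prepending the origin below the cones yields one more function,
    \<open>l + 1\<close> instead of \<open>l\<close>. This is the extra dimension of the cone and
    makes the bound strict.\<close>
  define W where "W = (\<lambda>i. case i of 0 \<Rightarrow> {\<lambda>_. 0} | Suc i \<Rightarrow> affine_cone (Z i))"
  have closed: "proj_closed I (Z i)" if "i \<le> l" for i using Z(1)[OF that] by (simp add: proj_irreducible_def)
  have "\<forall>i<Suc l. \<exists>f\<in>polyfun I. (\<forall>x\<in>W i. f x = 0) \<and> (\<exists>x\<in>W (Suc i). f x \<noteq> 0)"
  proof (intro allI impI)
    fix i assume i: "i < Suc l"
    show "\<exists>f\<in>polyfun I. (\<forall>x\<in>W i. f x = 0) \<and> (\<exists>x\<in>W (Suc i). f x \<noteq> 0)"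
    proof (cases i)
      case 0
      obtain P where P: "P \<in> Z 0" using Z(1)[of 0] by (auto simp: proj_irreducible_def)
      have "P \<in> projectivize (cspace I)" using P closed[of 0] by (auto simp: proj_closed_def)
      then obtain p where p: "P = proj_class p" "p \<in> cspace I" "p \<noteq> (\<lambda>_. 0)" by (auto simp: projectivize_def)
      from p(3) obtain k where k: "p k \<noteq> 0" by (auto simp: fun_eq_iff)
      with p(2) have "k \<in> I" by (auto simp: cspace_def)
      moreover have "p \<in> W (Suc i)" using 0 P p proj_class_self by (auto simp: W_def affine_cone_def)
      ultimately show ?thesis
        using k 0 by (intro bexI[of _ "\<lambda>x. x k"]) (auto simp: W_def intro: polyfun.coord)
    next
      case (Suc j)
      then obtain P where P: "P \<in> Z i" "P \<notin> Z j" using Z(3)[of j] i by auto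
      have "P \<in> projectivize (cspace I)" using P(1) closed[of i] i by (auto simp: proj_closed_def)
      then obtain p where p: "P = proj_class p" "p \<in> cspace I" "p \<noteq> (\<lambda>_. 0)" by (auto simp: projectivize_def)
      have j: "j \<le> l" using Suc i by simp
      have "p \<notin> affine_cone (Z j)" using p P(2) by (simp add: proj_closed_cone_iff[OF closed[OF j]])
      then obtain f where "f \<in> polyfun I" "\<forall>y\<in>affine_cone (Z j). f y = 0" "f p \<noteq> 0"
        using proj_closed_separate[OF closed[OF j] p(2)] by blast
      moreover have "p \<in> W (Suc i)" using P p proj_class_self by (auto simp: W_def affine_cone_def)
      ultimately show ?thesis using Suc by (intro bexI[of _ f]) (auto simp: W_def)
    qed
  qed
  then obtain f where f: "\<And>i. i < Suc l \<Longrightarrow> f i \<in> polyfun I"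
    "\<And>i x. i < Suc l \<Longrightarrow> x \<in> W i \<Longrightarrow> f i x = 0" "\<And>i. i < Suc l \<Longrightarrow> \<exists>x\<in>W (Suc i). f i x \<noteq> 0"
    by metis
  have "(\<lambda>y. f i (\<phi> y)) \<in> polyfun J" if "i \<in> {..<Suc l}" for i
    using that by (intro polyfun_compose[OF f(1) \<phi>]) simp_all
  from algebraic_dependence[OF J finite_lessThan card this]
  have "\<exists>F\<in>polys {..<Suc l}. F \<noteq> 0 \<and> (\<forall>y. peval F (\<lambda>i. f i (\<phi> y)) = 0)" .
  then obtain F where F: "F \<in> polys {..<Suc l}" "F \<noteq> 0" "\<And>y. peval F (\<lambda>i. f i (\<phi> y)) = 0" by blast
  have Fpoly: "(\<lambda>x. peval F (\<lambda>i. f i x)) \<in> polyfun I"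
    by (rule polyfun_compose[OF peval_polyfun[OF F(1)]]) (simp add: f(1))
  have "W (Suc l) \<subseteq> affine_cone X" using Z(2)[of l] by (auto simp: W_def affine_cone_def)
  then have 0: "peval F (\<lambda>i. f i x) = 0" if "x \<in> W (Suc l)" for x
    using zariski_closure_vanish[OF Fpoly, of "range \<phi>" x] X F(3) that by blast
  have "\<exists>x\<in>W (Suc l). (\<Sum>m\<in>Poly_Mapping.keys F. Poly_Mapping.lookup F m *
      (\<Prod>i<Suc l. f i x ^ Poly_Mapping.lookup m i)) \<noteq> 0"
  proof (rule chain_independent[where I = I])
    show "W i \<subseteq> W (Suc i)" if "i < Suc l" for i
    proof (cases i)
      case (Suc j)
      then have "Z j \<subseteq> Z i" using Z(3)[of j] that by auto
      then show ?thesis unfolding W_def affine_cone_def Suc nat.case by blast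
    qed (auto simp: W_def affine_cone_def)
    show "irreducible_set I (W (Suc i))" if "i < Suc l" for i
      using irreducible_affine_cone[OF Z(1)] that by (simp add: W_def)
    show "m = m'" if m: "m \<in> Poly_Mapping.keys F" "m' \<in> Poly_Mapping.keys F"
      "\<And>i. i < Suc l \<Longrightarrow> Poly_Mapping.lookup m i = Poly_Mapping.lookup m' i" for m m'
    proof (rule poly_mapping_eqI)
      fix k
      show "Poly_Mapping.lookup m k = Poly_Mapping.lookup m' k"
        using m polys_lookup_eq_0[OF F(1)] by (cases "k < Suc l") auto
    qed
  qed (use f F(2) in \<open>auto simp: W_def in_keys_iff\<close>)
  then obtain x where "x \<in> W (Suc l)" "peval F (\<lambda>i. f i x) \<noteq> 0"
    using F(1) by (auto simp: peval_finite[of "{..<Suc l}"])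
  then show False using 0 by blast
qed

text \<open>A supremum of natural numbers is meaningful only for a bounded set, so the dimension is
  certified as an attained maximum.\<close>

lemma local_dim_eqI:
  assumes "P \<in> Z 0" "\<And>i. i \<le> m \<Longrightarrow> proj_irreducible I (Z i)" "\<And>i. i \<le> m \<Longrightarrow> Z i \<subseteq> X"
      "\<And>i. i < m \<Longrightarrow> Z i \<subset> Z (Suc i)"
    and "\<And>l Z. \<lbrakk>\<And>i. i \<le> l \<Longrightarrow> proj_irreducible I (Z i); \<And>i. i \<le> l \<Longrightarrow> Z i \<subseteq> X;
      \<And>i. i < l \<Longrightarrow> Z i \<subset> Z (Suc i)\<rbrakk> \<Longrightarrow> l \<le> m"
  shows "local_dim I X P = m"
  unfolding local_dim_def
proof (rule cSup_eq_maximum)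
  show "m \<in> {l. \<exists>Z. P \<in> Z 0 \<and> (\<forall>i\<le>l. proj_irreducible I (Z i) \<and> Z i \<subseteq> X) \<and> (\<forall>i<l. Z i \<subset> Z (Suc i))}"
    using assms(1-4) by blast
qed (use assms(5) in blast)

section \<open>Geometry of the scroll\<close>

text \<open>Here \<open>m\<close> is \<open>d - 1\<close>, the number of rows and of blocks, and
  also the dimension of the scroll.\<close>

locale scroll =
  fixes m :: nat and n :: "nat \<Rightarrow> nat" and c :: "nat \<Rightarrow> nat \<Rightarrow> complex"
  assumes m: "m \<ge> 1"
    and n: "\<And>i. 1 \<le> i \<Longrightarrow> i \<le> m \<Longrightarrow> n i > 0"
    and c: "\<And>i j. 1 \<le> i \<Longrightarrow> i \<le> m \<Longrightarrow> j \<le> n i \<Longrightarrow> c i j \<noteq> 0"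
begin

abbreviation I :: "(nat \<times> nat) set" where "I \<equiv> scroll_columns (Suc m) n"

abbreviation V :: "(nat \<times> nat \<Rightarrow> complex) set set" where "V \<equiv> rational_normal_scroll (Suc m) n c"

text \<open>The factor \<open>s\<close> is merged with the other parameters: \<open>l i\<close> is
  \<open>s * \<theta> i\<close> for \<open>i < m\<close>, and \<open>l m\<close> is
  \<open>s\<close>. All blocks are then treated alike, although the matrix singles out the last
  one.\<close>

definition pt :: "(nat \<Rightarrow> complex) \<Rightarrow> complex \<Rightarrow> nat \<times> nat \<Rightarrow> complex" where
  "pt l t = (\<lambda>(i, j). if (i, j) \<in> I then c i j * l i * t ^ j else 0)"

definition torus :: "(nat \<times> nat \<Rightarrow> complex) set" where
  "torus = {pt l t | l t. t \<noteq> 0 \<and> (\<forall>i\<in>{1..m}. l i \<noteq> 0)}"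

lemma torusI: "t \<noteq> 0 \<Longrightarrow> (\<And>i. 1 \<le> i \<Longrightarrow> i \<le> m \<Longrightarrow> l i \<noteq> 0) \<Longrightarrow> pt l t \<in> torus"
  unfolding torus_def by (intro CollectI exI[of _ l] exI[of _ t]) auto

lemma I_iff: "(i, j) \<in> I \<longleftrightarrow> 1 \<le> i \<and> i \<le> m \<and> j \<le> n i"
  by (simp add: scroll_columns_def)

lemma I_eq: "I = Sigma {1..m} (\<lambda>i. {..n i})"
  by (auto simp: I_iff)

lemma finite_I: "finite I"
  by (simp add: I_eq)

lemma sum_I: "(\<Sum>k\<in>I. f k) = (\<Sum>i=1..m. \<Sum>j\<le>n i. f (i, j))"
  unfolding I_eq by (subst sum.Sigma) (auto simp: case_prod_eta)

lemma I0: "1 \<le> i \<Longrightarrow> i \<le> m \<Longrightarrow> (i, 0) \<in> I" "(m, 0) \<in> I" "(m, Suc 0) \<in> I"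
  using m n[of m] by (auto simp: I_iff)

lemma c_I: "(i, j) \<in> I \<Longrightarrow> c i j \<noteq> 0"
  using c by (simp add: I_iff)

lemma pt_apply: "(i, j) \<in> I \<Longrightarrow> pt l t (i, j) = c i j * l i * t ^ j"
  by (simp add: pt_def)

lemma pt_cspace: "pt l t \<in> cspace I"
  by (auto simp: pt_def cspace_def)

lemma torus_cspace: "torus \<subseteq> cspace I"
  using pt_cspace by (auto simp: torus_def)

lemma torus_nonzero: "p \<in> torus \<Longrightarrow> k \<in> I \<Longrightarrow> p k \<noteq> 0"
  by (cases k) (auto simp: torus_def pt_apply c_I, auto simp: I_iff)

lemma scale_pt: "(\<lambda>k. a * pt l t k) = pt (\<lambda>i. a * l i) t"
  by (auto simp: pt_def fun_eq_iff)

lemma conical_torus: "conical torus"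
  unfolding conical_def torus_def by (fastforce simp: scale_pt)

text \<open>Packs the original parameters into one vector indexed by \<open>{0..m}\<close>:
  \<open>y 0\<close> is \<open>s\<close> and \<open>y m\<close> is the last \<open>\<theta>\<close>.
  Its \<open>m + 1\<close> entries are the variables in the dimension bound.\<close>

definition \<phi> :: "(nat \<Rightarrow> complex) \<Rightarrow> nat \<times> nat \<Rightarrow> complex" where
  "\<phi> y = pt (\<lambda>i. y 0 * (if i < m then y i else 1)) (y m)"

lemma torus_eq_image: "torus = \<phi> ` {y. \<forall>r\<le>m. y r \<noteq> 0}"
proof (intro equalityI subsetI)
  fix p assume "p \<in> torus"
  then obtain l t where p: "p = pt l t" "t \<noteq> 0" "\<forall>i\<in>{1..m}. l i \<noteq> 0" by (auto simp: torus_def)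
  \<comment> \<open>Dividing by \<open>l m\<close>, which equals \<open>s\<close>, undoes the
    merging of the parameters.\<close>
  define y where "y = (\<lambda>r. if r = 0 then l m else if r = m then t else l r / l m)"
  have "y r \<noteq> 0" if "r \<le> m" for r using p(2,3) m that by (auto simp: y_def)
  moreover have "p = \<phi> y"
    unfolding p(1) \<phi>_def using m p(3) by (auto simp: pt_def y_def I_iff fun_eq_iff)
  ultimately show "p \<in> \<phi> ` {y. \<forall>r\<le>m. y r \<noteq> 0}" by blast
next
  fix p assume "p \<in> \<phi> ` {y. \<forall>r\<le>m. y r \<noteq> 0}"
  then obtain y where "p = \<phi> y" "\<forall>r\<le>m. y r \<noteq> 0" by blast
  then show "p \<in> torus" by (auto simp: \<phi>_def intro!: torusI split: if_splits)
qed

lemma scroll_eq: "V = projectivize (zariski_closure I torus)"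
proof -
  have eq: "(\<Prod>r=1..m. \<theta> r powi scroll_matrix (Suc m) r (i, j)) = (if i < m then \<theta> i else 1) * \<theta> m ^ j"
    if "1 \<le> i" "i \<le> m" for \<theta> :: "nat \<Rightarrow> complex" and i j
  proof -
    have "(\<Prod>r=1..m. \<theta> r powi scroll_matrix (Suc m) r (i, j)) =
      (\<Prod>r=1..m. (if r = i \<and> i < m then \<theta> i else 1) * (if r = m then \<theta> m ^ j else 1))"
      using that by (intro prod.cong) (auto simp: scroll_matrix_def)
    also have "\<dots> = (if i < m then \<theta> i else 1) * \<theta> m ^ j"
      unfolding prod.distrib using that m by (cases "i < m") (simp_all add: prod.delta)
    finally show ?thesis .
  qed
  have "{(\<lambda>k. if k \<in> I then (case k of (i, j) \<Rightarrow> c i j) * s * (\<Prod>r=1..m. \<theta> r powi scroll_matrix (Suc m) r k) else 0) | s \<theta>.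
        s \<noteq> 0 \<and> (\<forall>r\<in>{1..m}. \<theta> r \<noteq> 0)} = {\<phi> (\<theta>(0 := s)) | s \<theta>. s \<noteq> 0 \<and> (\<forall>r\<in>{1..m}. \<theta> r \<noteq> 0)}"
  proof -
    have "(\<lambda>k. if k \<in> I then (case k of (i, j) \<Rightarrow> c i j) * s * (\<Prod>r=1..m. \<theta> r powi scroll_matrix (Suc m) r k) else 0)
        = \<phi> (\<theta>(0 := s))" for s \<theta>
    proof (rule ext)
      fix k :: "nat \<times> nat"
      obtain i j where k: "k = (i, j)" by (cases k)
      show "(if k \<in> I then (case k of (i, j) \<Rightarrow> c i j) * s *
          (\<Prod>r=1..m. \<theta> r powi scroll_matrix (Suc m) r k) else 0) = \<phi> (\<theta>(0 := s)) k"
      proof (cases "(i, j) \<in> I")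
        case True
        then show ?thesis unfolding k using m eq[of i \<theta> j] by (auto simp: I_iff \<phi>_def pt_def)
      qed (simp add: k \<phi>_def pt_def)
    qed
    then show ?thesis by simp
  qed
  also have "\<dots> = torus"
    unfolding torus_eq_image
  proof (intro equalityI subsetI)
    fix p assume "p \<in> \<phi> ` {y. \<forall>r\<le>m. y r \<noteq> 0}"
    then obtain y where "p = \<phi> y" "\<forall>r\<le>m. y r \<noteq> 0" by blast
    then show "p \<in> {\<phi> (\<theta>(0 := s)) | s \<theta>. s \<noteq> 0 \<and> (\<forall>r\<in>{1..m}. \<theta> r \<noteq> 0)}"
      by (intro CollectI exI[of _ "y 0"] exI[of _ y]) auto
  next
    fix p assume "p \<in> {\<phi> (\<theta>(0 := s)) | s \<theta>. s \<noteq> 0 \<and> (\<forall>r\<in>{1..m}. \<theta> r \<noteq> 0)}"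
    then obtain s \<theta> where "p = \<phi> (\<theta>(0 := s))" "s \<noteq> 0" "\<forall>r\<in>{1..m}. \<theta> r \<noteq> 0" by blast
    then show "p \<in> \<phi> ` {y. \<forall>r\<le>m. y r \<noteq> 0}" by (intro image_eqI[of _ _ "\<theta>(0 := s)"]) auto
  qed
  finally show ?thesis
    by (simp add: rational_normal_scroll_def scaled_toric_variety_def)
qed

lemma torus_nonempty: "torus \<noteq> {}"
proof -
  have "pt (\<lambda>_. 1) 1 \<in> torus" by (rule torusI) auto
  then show ?thesis by blast
qed

lemma affine_cone_V: "affine_cone V = zariski_closure I torus"
  unfolding scroll_eq by (rule affine_cone_closure[OF conical_torus torus_nonempty])

text \<open>A scaled 2 by 2 minor comparing the ratio of two neighbours in block \<open>i\<close>
  with the ratio at the start of block \<open>m\<close>. Off the coordinate hyperplanes these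
  equations say that all rescaled ratios agree; their common value is \<open>t\<close>.\<close>

definition binomial :: "nat \<Rightarrow> nat \<Rightarrow> (nat \<times> nat \<Rightarrow> complex) \<Rightarrow> complex" where
  "binomial i j x = (c i j * c m 1) * (x (i, Suc j) * x (m, 0)) -
     (c i (Suc j) * c m 0) * (x (i, j) * x (m, 1))"

lemma binomial_polyfun: "(i, Suc j) \<in> I \<Longrightarrow> binomial i j \<in> polyfun I"
  unfolding binomial_def[abs_def] using I0
  by (intro polyfun_intros) (auto simp: I_iff)

lemma binomial_torus:
  assumes "(i, Suc j) \<in> I" "x \<in> torus"
  shows "binomial i j x = 0"
proof -
  have "(i, j) \<in> I" using assms(1) by (simp add: I_iff)
  then show ?thesis
    using assms I0 by (auto simp: binomial_def torus_def pt_apply)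
qed

lemma closure_nonzero_torus:
  assumes "x \<in> zariski_closure I torus" "\<And>k. k \<in> I \<Longrightarrow> x k \<noteq> 0"
  shows "x \<in> torus"
proof -
  \<comment> \<open>The ratio shared by all the binomials determines \<open>t\<close>, and the first
    column of each block determines \<open>l\<close>.\<close>
  define t where "t = x (m, 1) * c m 0 / (c m 1 * x (m, 0))"
  define l where "l = (\<lambda>i. x (i, 0) / c i 0)"
  have nz: "c m 0 \<noteq> 0" "c m 1 \<noteq> 0" "x (m, 0) \<noteq> 0" "x (m, 1) \<noteq> 0"
    using I0 assms(2) c_I by auto
  have "x (i, j) = c i j * l i * t ^ j" if "(i, j) \<in> I" for i j
    using that
  proof (induction j)
    case 0
    then show ?case using c_I[OF 0] by (simp add: l_def)
  next
    case (Suc j)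
    then have ij: "(i, j) \<in> I" by (simp add: I_iff)
    have "binomial i j x = 0"
      using zariski_closure_vanish[OF binomial_polyfun binomial_torus assms(1)] Suc.prems by blast
    then have "x (i, Suc j) = c i (Suc j) * (x (i, j) / c i j) * t"
      using nz c_I[OF ij] by (simp add: binomial_def t_def field_simps)
    then show ?case using Suc.IH[OF ij] c_I[OF ij] by simp
  qed
  moreover have "x k = 0" if "k \<notin> I" for k
    using assms(1) that unfolding zariski_closure_def cspace_def by blast
  ultimately have "x = pt l t" by (auto simp: pt_def fun_eq_iff)
  moreover have "t \<noteq> 0" using nz by (simp add: t_def)
  moreover have "l i \<noteq> 0" if "i \<in> {1..m}" for i
    using that assms(2) c_I I0(1)[of i] by (simp add: l_def)
  ultimately show ?thesis unfolding torus_def by blast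
qed

text \<open>The velocity of \<open>pt l t\<close> when each \<open>l i\<close> changes at relative
  rate \<open>\<alpha> i\<close> and \<open>t\<close> at relative rate
  \<open>\<beta>\<close>.\<close>

definition tangent :: "(nat \<times> nat \<Rightarrow> complex) \<Rightarrow> (nat \<Rightarrow> complex) \<Rightarrow> complex \<Rightarrow> nat \<times> nat \<Rightarrow> complex" where
  "tangent p \<alpha> \<beta> = (\<lambda>(i, j). p (i, j) * (\<alpha> i + of_nat j * \<beta>))"

lemma binomial_line_deriv:
  "((\<lambda>t. binomial i j (\<lambda>k. p k + t * v k)) has_field_derivative
     (c i j * c m 1) * (v (i, Suc j) * p (m, 0) + p (i, Suc j) * v (m, 0)) -
     (c i (Suc j) * c m 0) * (v (i, j) * p (m, 1) + p (i, j) * v (m, 1))) (at 0)"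
  unfolding binomial_def by (auto intro!: derivative_eq_intros simp: algebra_simps)

text \<open>The binomials bound the tangent space from above. For the lower bound every polynomial
  of the ideal has to be treated, which is done by differentiating it along curves inside the
  torus.\<close>

lemma cone_tangent_torus:
  assumes "p \<in> torus"
  shows "cone_tangent I V p = {tangent p \<alpha> \<beta> | \<alpha> \<beta>. True}"
proof (intro equalityI subsetI)
  fix v assume v: "v \<in> cone_tangent I V p"
  \<comment> \<open>In logarithmic velocities the linearized binomial reads
    \<open>w (i, Suc j) - w (i, j) = w (m, 1) - w (m, 0)\<close>, so \<open>w\<close> is an
    arithmetic progression in each block, with common difference \<open>\<beta>\<close>.\<close>
  define w where "w = (\<lambda>k. v k / p k)"
  have vw: "v k = p k * w k" if "k \<in> I" for k
    using torus_nonzero[OF assms that] by (simp add: w_def)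
  define \<beta> where "\<beta> = w (m, 1) - w (m, 0)"
  have step: "w (i, Suc j) = w (i, j) + \<beta>" if ij: "(i, Suc j) \<in> I" for i j
  proof -
    have ij': "(i, j) \<in> I" using ij by (simp add: I_iff)
    obtain F where F: "F \<in> polys I" "\<And>x. binomial i j x = peval F x"
      using polyfun_imp_peval[OF binomial_polyfun[OF ij]] by blast
    have "F \<in> vanishing_ideal I (affine_cone V)"
      unfolding vanishing_ideal_def affine_cone_V
      using F zariski_closure_vanish[OF binomial_polyfun[OF ij] binomial_torus[OF ij]] by auto
    then have "((\<lambda>t. binomial i j (\<lambda>k. p k + t * v k)) has_field_derivative 0) (at 0)"
      using v by (simp add: cone_tangent_def F(2))
    then have "(c i j * c m 1) * (v (i, Suc j) * p (m, 0) + p (i, Suc j) * v (m, 0)) -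
     (c i (Suc j) * c m 0) * (v (i, j) * p (m, 1) + p (i, j) * v (m, 1)) = 0"
      using binomial_line_deriv DERIV_unique by blast
    moreover have "c i j * c m 1 * p (i, Suc j) * p (m, 0) = c i (Suc j) * c m 0 * p (i, j) * p (m, 1)"
      using binomial_torus[OF ij assms] by (simp add: binomial_def mult.assoc)
    ultimately have "(c i j * c m 1 * p (i, Suc j) * p (m, 0)) * (w (i, Suc j) + w (m, 0) - (w (i, j) + w (m, 1))) = 0"
      using vw[OF ij] vw[OF ij'] vw[OF I0(2)] vw[OF I0(3)] unfolding One_nat_def by algebra
    moreover have "c i j * c m 1 * p (i, Suc j) * p (m, 0) \<noteq> 0"
      using c_I[OF ij'] c_I[OF I0(3)] torus_nonzero[OF assms ij] torus_nonzero[OF assms I0(2)] by simp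
    ultimately have "w (i, Suc j) + w (m, 0) - (w (i, j) + w (m, 1)) = 0" by (meson mult_eq_0_iff)
    then show ?thesis by (simp add: \<beta>_def algebra_simps)
  qed
  have wj: "w (i, j) = w (i, 0) + of_nat j * \<beta>" if "(i, j) \<in> I" for i j
    using that
  proof (induction j)
    case (Suc j)
    then have "(i, j) \<in> I" by (simp add: I_iff)
    then show ?case using Suc.IH step[OF Suc.prems] by (simp add: algebra_simps)
  qed simp
  have "v = tangent p (\<lambda>i. w (i, 0)) \<beta>"
  proof (rule ext, clarify)
    fix i j
    show "v (i, j) = tangent p (\<lambda>i. w (i, 0)) \<beta> (i, j)"
    proof (cases "(i, j) \<in> I")
      case True
      then show ?thesis using vw[OF True] wj[OF True] by (simp add: tangent_def)
    next
      case False
      moreover have "v \<in> cspace I" using v by (simp add: cone_tangent_def)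
      moreover have "p \<in> cspace I" using assms torus_cspace by blast
      ultimately show ?thesis by (simp add: cspace_def tangent_def)
    qed
  qed
  then show "v \<in> {tangent p \<alpha> \<beta> | \<alpha> \<beta>. True}" by blast
next
  fix v assume "v \<in> {tangent p \<alpha> \<beta> | \<alpha> \<beta>. True}"
  then obtain \<alpha> \<beta> where v: "v = tangent p \<alpha> \<beta>" by blast
  obtain l t where p: "p = pt l t" "t \<noteq> 0" "\<forall>i\<in>{1..m}. l i \<noteq> 0" using assms by (auto simp: torus_def)
  \<comment> \<open>This curve has velocity \<open>v\<close> at \<open>s = 0\<close> and stays in
    the torus for small \<open>s\<close>, so every polynomial of the ideal is constantly 0 along it
    near \<open>s = 0\<close>.\<close>
  define \<gamma> where "\<gamma> = (\<lambda>s. pt (\<lambda>i. l i * (1 + s * \<alpha> i)) (t * (1 + s * \<beta>)))"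
  have \<gamma>_deriv: "((\<lambda>s. \<gamma> s (i, j)) has_field_derivative v (i, j)) (at 0)" if "(i, j) \<in> I" for i j
    unfolding v tangent_def p(1) \<gamma>_def
    by (auto simp: pt_apply that power_mult_distrib intro!: derivative_eq_intros) (simp add: algebra_simps)
  have "eventually (\<lambda>s. 1 + s * a \<noteq> 0) (at (0::complex))" for a
  proof -
    have "((\<lambda>s. 1 + s * a) \<longlongrightarrow> 1 + 0 * a) (at 0)" by (intro tendsto_intros)
    then show ?thesis by (intro tendsto_imp_eventually_ne) auto
  qed
  then have "eventually (\<lambda>s. (\<forall>i\<in>{1..m}. 1 + s * \<alpha> i \<noteq> 0) \<and> 1 + s * \<beta> \<noteq> 0) (at (0::complex))"
    by (intro eventually_conj eventually_ball_finite) auto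
  moreover have "\<gamma> s \<in> torus" if "(\<forall>i\<in>{1..m}. 1 + s * \<alpha> i \<noteq> 0) \<and> 1 + s * \<beta> \<noteq> 0" for s
    unfolding \<gamma>_def using that p(2,3) by (intro torusI) auto
  ultimately have \<gamma>_torus: "eventually (\<lambda>s. \<gamma> s \<in> torus) (at 0)" by (rule eventually_mono)
  have "((\<lambda>t. peval F (\<lambda>k. p k + t * v k)) has_field_derivative 0) (at 0)"
    if F: "F \<in> vanishing_ideal I (affine_cone V)" for F
  proof -
    have F0: "peval F x = 0" if "x \<in> torus" for x
      using F that zariski_closure_superset[OF torus_cspace] by (auto simp: vanishing_ideal_def affine_cone_V)
    have "peval F \<in> polyfun I" using F by (auto simp: vanishing_ideal_def intro: peval_polyfun)
    then obtain D where D: "\<And>\<gamma> v. (\<forall>k\<in>I. \<gamma> 0 k = p k \<and> ((\<lambda>t. \<gamma> t k) has_field_derivative v k) (at 0))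
           \<Longrightarrow> ((\<lambda>t. peval F (\<gamma> t)) has_field_derivative D v) (at 0)"
      using polyfun_differential[of "peval F" I p] by blast
    have \<gamma>0: "\<gamma> 0 = p" by (simp add: \<gamma>_def p(1))
    have "((\<lambda>t. peval F (\<gamma> t)) has_field_derivative D v) (at 0)"
      by (rule D) (auto simp: \<gamma>0 \<gamma>_deriv)
    moreover have "eventually (\<lambda>s. peval F (\<gamma> s) = 0) (at 0)"
      using \<gamma>_torus by (rule eventually_mono) (rule F0)
    then have "eventually (\<lambda>s. peval F (\<gamma> s) = 0) (nhds 0)"
      unfolding eventually_nhds_conv_at by (simp add: \<gamma>0 F0 assms)
    ultimately have "((\<lambda>_. 0) has_field_derivative D v) (at 0)"
      by (subst (asm) DERIV_cong_ev[OF refl _ refl]) auto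
    then have "D v = 0" using DERIV_unique DERIV_const by blast
    moreover have "((\<lambda>t. peval F (\<lambda>k. p k + t * v k)) has_field_derivative D v) (at 0)"
      by (rule D) (auto intro!: derivative_eq_intros)
    ultimately show ?thesis by simp
  qed
  moreover have "v \<in> cspace I"
    using assms torus_cspace unfolding v by (auto simp: cspace_def tangent_def)
  ultimately show "v \<in> cone_tangent I V p" unfolding cone_tangent_def by blast
qed

section \<open>Smoothness of the torus points\<close>

context
begin

interpretation cfun: vector_space "\<lambda>(a::complex) (f::'a \<Rightarrow> complex) k. a * f k"
  by (rule vector_space_cfun)

lemma cdim_cone_tangent:
  assumes "p \<in> torus"
  shows "cdim (cone_tangent I V p) = m + 1"
proof -
  \<comment> \<open>Blocks are numbered from 1, so index 0 is free for the direction of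
    \<open>t\<close>; \<open>b r\<close> with \<open>r \<ge> 1\<close> rescales block
    \<open>r\<close>. Independence is read off at the columns \<open>(r, 0)\<close> and then at
    \<open>(m, 1)\<close>.\<close>
  define b where "b = (\<lambda>r. tangent p (\<lambda>i. if i = r \<and> r \<noteq> 0 then 1 else 0) (if r = 0 then 1 else 0))"
  have p0: "p (r, j) = 0" if "r = 0" for r j
    using assms torus_cspace that by (auto simp: cspace_def I_iff)
  have b_r0: "b r' (r, 0) = (if r' = r then p (r, 0) else 0)" if "r \<noteq> 0" for r r'
    using that by (auto simp: b_def tangent_def)
  have b_0: "b 0 (m, 1) = p (m, 1)"
    by (simp add: b_def tangent_def)
  have pr: "p (r, 0) \<noteq> 0" if "1 \<le> r" "r \<le> m" for r using torus_nonzero[OF assms I0(1)] that by blast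
  have pm: "p (m, 1) \<noteq> 0" using torus_nonzero[OF assms I0(3)] by simp
  have comb: "(\<Sum>r\<in>{0..m}. (\<lambda>k. u r * b r k)) = tangent p u (u 0)" for u
  proof (rule ext, clarify)
    fix i j
    have "(\<Sum>r\<in>{0..m}. (\<lambda>k. u r * b r k)) (i, j) = (\<Sum>r\<in>{0..m}. u r * b r (i, j))"
      by (rule sum_apply)
    also have "\<dots> = p (i, j) * (\<Sum>r\<in>{0..m}. (if r = i \<and> r \<noteq> 0 then u r else 0) + (if r = 0 then u r * of_nat j else 0))"
      unfolding sum_distrib_left b_def tangent_def by (intro sum.cong) auto
    also have "\<dots> = p (i, j) * ((if i \<noteq> 0 \<and> i \<le> m then u i else 0) + u 0 * of_nat j)"
    proof -
      have "(\<Sum>r\<in>{0..m}. if r = i \<and> r \<noteq> 0 then u r else 0) = (\<Sum>r\<in>{0..m}. if r = i then if i \<noteq> 0 then u i else 0 else 0)"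
        by (intro sum.cong) auto
      then show ?thesis by (simp add: sum.distrib sum.delta)
    qed
    also have "\<dots> = tangent p u (u 0) (i, j)"
    proof (cases "(i, j) \<in> I")
      case False
      then have "p (i, j) = 0" using assms torus_cspace by (auto simp: cspace_def)
      then show ?thesis by (simp add: tangent_def)
    qed (auto simp: tangent_def I_iff)
    finally show "(\<Sum>r\<in>{0..m}. (\<lambda>k. u r * b r k)) (i, j) = tangent p u (u 0) (i, j)" .
  qed
  have inj: "inj_on b {0..m}"
  proof (rule inj_onI)
    fix r r' assume r: "r \<in> {0..m}" "r' \<in> {0..m}" "b r = b r'"
    show "r = r'"
    proof (rule ccontr)
      assume "r \<noteq> r'"
      then show False
        using b_r0[of r r'] b_r0[of r r] b_r0[of r' r] b_r0[of r' r'] r pr[of r] pr[of r'] by (cases "r = 0") auto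
    qed
  qed
  have indep: "\<not> cfun.dependent (b ` {0..m})"
  proof
    assume "cfun.dependent (b ` {0..m})"
    then obtain u v where u: "v \<in> b ` {0..m}" "u v \<noteq> 0" "(\<Sum>v\<in>b ` {0..m}. (\<lambda>k. u v * v k)) = 0"
      by (subst (asm) cfun.dependent_finite) auto
    have z: "tangent p (\<lambda>r. u (b r)) (u (b 0)) k = 0" for k
      using u(3) by (simp add: sum.reindex[OF inj] comb)
    have r: "u (b r) = 0" if "1 \<le> r" "r \<le> m" for r
      using z[of "(r, 0)"] pr[OF that] by (simp add: tangent_def)
    then have "u (b 0) = 0" using z[of "(m, 1)"] pm m by (simp add: tangent_def)
    with r u(1,2) show False by (metis One_nat_def atLeastAtMost_iff imageE less_one not_le)
  qed
  have "cfun.dim {tangent p \<alpha> \<beta> | \<alpha> \<beta>. True} = m + 1"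
  proof (rule cfun.dim_unique)
    show "b ` {0..m} \<subseteq> {tangent p \<alpha> \<beta> | \<alpha> \<beta>. True}" unfolding b_def by blast
    show "{tangent p \<alpha> \<beta> | \<alpha> \<beta>. True} \<subseteq> cfun.span (b ` {0..m})"
    proof
      fix v assume "v \<in> {tangent p \<alpha> \<beta> | \<alpha> \<beta>. True}"
      then obtain \<alpha> \<beta> where v: "v = tangent p \<alpha> \<beta>" by blast
      have "v = tangent p (\<alpha>(0 := \<beta>)) ((\<alpha>(0 := \<beta>)) 0)"
        unfolding v tangent_def using p0 by (auto simp: fun_eq_iff)
      also have "\<dots> = (\<Sum>r\<in>{0..m}. (\<lambda>k. (\<alpha>(0 := \<beta>)) r * b r k))" by (rule comb[symmetric])
      also have "\<dots> \<in> cfun.span (b ` {0..m})"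
        by (intro cfun.span_sum cfun.span_scale cfun.span_base imageI)
      finally show "v \<in> cfun.span (b ` {0..m})" .
    qed
    show "card (b ` {0..m}) = m + 1" by (simp add: card_image[OF inj])
  qed (rule indep)
  then show ?thesis unfolding cdim_def cone_tangent_torus[OF assms] .
qed

end

lemma \<phi>_polyfun: "k \<in> I \<Longrightarrow> (\<lambda>y. \<phi> y k) \<in> polyfun {0..m}"
proof (cases k)
  case (Pair i j)
  assume k: "k \<in> I"
  have 1: "(\<lambda>y. if i < m then y i else (1::complex)) \<in> polyfun {0..m}"
    by (cases "i < m") (auto intro: polyfun.intros)
  have "(\<lambda>y. c i j * (y 0 * (if i < m then y i else 1)) * y m ^ j) \<in> polyfun {0..m}"
    by (intro polyfun_intros 1) auto
  then show ?thesis using k Pair by (simp add: \<phi>_def pt_apply)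
qed

text \<open>A chain through a torus point is obtained by freeing the coordinates of the torus one by one.\<close>

lemma local_dim_torus:
  assumes "p \<in> torus"
  shows "local_dim I V (proj_class p) = m"
proof -
  obtain y0 where y0: "p = \<phi> y0" "\<forall>r\<le>m. y0 r \<noteq> 0" using assms torus_eq_image by auto
  \<comment> \<open>Coordinate 0 is the scaling and is free already in \<open>Y 0\<close>:
    \<open>S 0\<close> is the punctured line through \<open>p\<close> and \<open>Z 0\<close> a
    single point, so that freeing the coordinates from 1 to \<open>m\<close> gives exactly
    \<open>m\<close> steps.\<close>
  define Y where "Y = (\<lambda>k. {y. (\<forall>r\<le>m. y r \<noteq> 0) \<and> (\<forall>r. k < r \<and> r \<le> m \<longrightarrow> y r = y0 r)})"
  define S where "S = (\<lambda>k. \<phi> ` Y k)"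
  define Z where "Z = (\<lambda>k. projectivize (zariski_closure I (S k)))"
  have pS: "p \<in> S k" for k using y0 by (auto simp: S_def Y_def)
  have S_torus: "S k \<subseteq> torus" for k unfolding torus_eq_image S_def Y_def by auto
  have S_cspace: "S k \<subseteq> cspace I" for k using S_torus torus_cspace by blast
  have p_nz: "p \<noteq> (\<lambda>_. 0)" using torus_nonzero[OF assms I0(2)] by auto
  have S_mono: "S k \<subseteq> S (Suc k)" for k unfolding S_def Y_def by auto
  have conical: "conical (S k)" for k
    unfolding conical_def
  proof (intro ballI allI impI)
    fix x and t :: complex assume x: "x \<in> S k" and t: "t \<noteq> 0"
    then obtain y where y: "y \<in> Y k" "x = \<phi> y" by (auto simp: S_def)
    have "(\<lambda>k. t * x k) = \<phi> (y(0 := t * y 0))"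
      using m unfolding y(2) \<phi>_def scale_pt by (auto simp: pt_def fun_eq_iff I_iff)
    moreover have "y(0 := t * y 0) \<in> Y k" using y(1) t by (auto simp: Y_def)
    ultimately show "(\<lambda>k. t * x k) \<in> S k" by (auto simp: S_def)
  qed
  have irr: "irreducible_set I (S k)" for k
  proof (rule irreducible_set_curves)
    fix x x' assume "x \<in> S k" "x' \<in> S k"
    then obtain y y' where y: "y \<in> Y k" "x = \<phi> y" "y' \<in> Y k" "x' = \<phi> y'" by (auto simp: S_def)
    define \<gamma> where "\<gamma> = (\<lambda>t r. (1 - t) * y r + t * y' r)"
    have line: "\<exists>q. \<forall>t. \<gamma> t r = poly q t" for r
      by (rule exI[of _ "[:y r, y' r - y r:]"]) (simp add: \<gamma>_def algebra_simps)
    have "{t. \<phi> (\<gamma> t) \<notin> S k} \<subseteq> (\<Union>r\<in>{..m}. {t. \<gamma> t r = 0})"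
    proof
      fix t assume t: "t \<in> {t. \<phi> (\<gamma> t) \<notin> S k}"
      have "\<gamma> t r = y0 r" if "k < r" "r \<le> m" for r
        using y that by (auto simp: Y_def \<gamma>_def algebra_simps)
      then have "\<exists>r\<le>m. \<gamma> t r = 0" using t by (auto simp: S_def Y_def)
      then show "t \<in> (\<Union>r\<in>{..m}. {t. \<gamma> t r = 0})" by blast
    qed
    moreover have "finite {t. \<gamma> t r = 0}" if r: "r \<le> m" for r
    proof -
      obtain q where q: "\<forall>t. \<gamma> t r = poly q t" using line by blast
      have "poly q 0 = y r" using q[rule_format, of 0] by (simp add: \<gamma>_def)
      then have "q \<noteq> 0" using y(1) r by (auto simp: Y_def)
      then show ?thesis using poly_roots_finite[of q] q by simp
    qed
    ultimately have "finite {t. \<phi> (\<gamma> t) \<notin> S k}" using finite_subset by blast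
    moreover have "\<exists>q. \<forall>t. \<phi> (\<gamma> t) j = poly q t" if "j \<in> I" for j
      using polyfun_curve[OF \<phi>_polyfun[OF that]] line by blast
    moreover have "\<phi> (\<gamma> 0) = x" "\<phi> (\<gamma> 1) = x'" by (simp_all add: \<gamma>_def y)
    ultimately show "\<exists>\<gamma>. \<gamma> 0 = x \<and> \<gamma> 1 = x' \<and> finite {t. \<gamma> t \<notin> S k} \<and>
      (\<forall>k\<in>I. \<exists>p. \<forall>t. \<gamma> t k = poly p t)"
      by (intro exI[of _ "\<lambda>t. \<phi> (\<gamma> t)"]) auto
  qed
  have strict: "Z k \<subset> Z (Suc k)" if k: "k < m" for k
  proof -
    define r where "r = Suc k"
    \<comment> \<open>The parameter \<open>y r\<close> is the rescaled ratio of column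
      \<open>(r, 0)\<close> to \<open>(m, 0)\<close> if \<open>r < m\<close>, and of
      \<open>(m, 1)\<close> to \<open>(m, 0)\<close> if \<open>r = m\<close>. The function
      \<open>h\<close> tests whether it still has the value \<open>y0 r\<close>.\<close>
    define j where "j = (if r < m then 0 else Suc 0)"
    have r: "1 \<le> r" "r \<le> m" using k by (auto simp: r_def)
    have rj: "(r, j) \<in> I" using r I0 by (cases "r = m") (auto simp: j_def)
    define h where "h = (\<lambda>x. c m 0 * x (r, j) - y0 r * c r j * x (m, 0))"
    have h: "h \<in> polyfun I"
      unfolding h_def using rj I0 by (intro polyfun_intros)
    have h_\<phi>: "h (\<phi> y) = c m 0 * c r j * y 0 * (y r - y0 r)" for y
      using rj I0 r by (cases "r = m") (auto simp: h_def \<phi>_def pt_apply j_def algebra_simps)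
    have h0: "h x = 0" if "x \<in> S k" for x
      using that r by (auto simp: S_def Y_def h_\<phi> r_def)
    define x where "x = \<phi> (y0(r := 2 * y0 r))"
    have xS: "x \<in> S (Suc k)" using y0(2) by (auto simp: S_def Y_def x_def r_def)
    have "h x \<noteq> 0"
      unfolding x_def h_\<phi> using c_I[OF rj] c_I[OF I0(2)] y0(2) r by auto
    then have "x \<notin> zariski_closure I (S k)" using zariski_closure_vanish[OF h h0] by blast
    then have "proj_class x \<notin> Z k"
      by (simp add: Z_def proj_class_in_projectivize conical_closure conical)
    moreover have "proj_class x \<in> Z (Suc k)"
    proof -
      have "x \<noteq> (\<lambda>_. 0)" using xS S_torus torus_nonzero I0(2) by fastforce
      moreover have "x \<in> zariski_closure I (S (Suc k))"
        using xS zariski_closure_superset[OF S_cspace] by blast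
      ultimately show ?thesis
        by (simp add: Z_def proj_class_in_projectivize conical_closure conical)
    qed
    moreover have "Z k \<subseteq> Z (Suc k)"
      unfolding Z_def projectivize_def using zariski_closure_mono[OF S_mono] by blast
    ultimately show ?thesis by blast
  qed
  show ?thesis
  proof (rule local_dim_eqI)
    have "p \<in> zariski_closure I (S 0)" using pS zariski_closure_superset[OF S_cspace] by blast
    then show "proj_class p \<in> Z 0" unfolding Z_def projectivize_def using p_nz by blast
    show "proj_irreducible I (Z i)" for i
      unfolding Z_def by (rule proj_irreducible_closure[OF S_cspace conical irr pS p_nz])
    show "Z i \<subseteq> V" for i
      unfolding Z_def scroll_eq projectivize_def using zariski_closure_mono[OF S_torus] by blast
    show "Z i \<subset> Z (Suc i)" if "i < m" for i by (rule strict[OF that])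
    fix l Z assume Z: "\<And>i. i \<le> l \<Longrightarrow> proj_irreducible I (Z i)" "\<And>i. i \<le> l \<Longrightarrow> Z i \<subseteq> V"
      "\<And>i. i < l \<Longrightarrow> Z i \<subset> Z (Suc i)"
    have "affine_cone V \<subseteq> zariski_closure I (range \<phi>)"
      unfolding affine_cone_V by (rule zariski_closure_mono) (auto simp: torus_eq_image)
    then have "l < card {0..m}"
      using Z \<phi>_polyfun by (intro chain_length_less[where \<phi> = \<phi> and I = I and X = V and Z = Z]) auto
    then show "l \<le> m" by simp
  qed
qed

lemma proj_class_torus:
  assumes "p \<in> torus" "q \<in> proj_class p"
  shows "q \<in> torus"
  using assms conicalD[OF conical_torus] unfolding proj_class_iff by blast

text \<open>A point of the closure outside the torus has a zero coordinate; at torus points the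
  tangent space of the cone has dimension \<open>m + 1\<close> and the local dimension is
  \<open>m\<close>.\<close>

lemma smooth_off_hyperplanes:
  "P \<in> smooth_points I V - hyperplanes I \<longleftrightarrow> (\<exists>p\<in>torus. (\<Sum>k\<in>I. p k) \<noteq> 0 \<and> P = proj_class p)"
proof
  assume P: "P \<in> smooth_points I V - hyperplanes I"
  then have "P \<in> V" by (simp add: smooth_points_def)
  then obtain p where p: "p \<in> zariski_closure I torus" "p \<noteq> (\<lambda>_. 0)" "P = proj_class p"
    unfolding scroll_eq projectivize_def by blast
  have "P \<in> projectivize (cspace I)"
    using p zariski_closure_cspace by (auto simp: projectivize_def)
  then have nz: "(\<forall>k\<in>I. p k \<noteq> 0) \<and> (\<Sum>k\<in>I. p k) \<noteq> 0"
    using P proj_class_self[of p] p(3) unfolding hyperplanes_def by blast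
  then have "p \<in> torus" using closure_nonzero_torus p(1) by blast
  then show "\<exists>p\<in>torus. (\<Sum>k\<in>I. p k) \<noteq> 0 \<and> P = proj_class p" using nz p(3) by blast
next
  assume "\<exists>p\<in>torus. (\<Sum>k\<in>I. p k) \<noteq> 0 \<and> P = proj_class p"
  then obtain p where p: "p \<in> torus" "(\<Sum>k\<in>I. p k) \<noteq> 0" "P = proj_class p" by blast
  have "p \<noteq> (\<lambda>_. 0)" using torus_nonzero[OF p(1) I0(2)] by auto
  then have "P \<in> V"
    using p(1,3) zariski_closure_superset[OF torus_cspace] unfolding scroll_eq projectivize_def by blast
  moreover have "cdim (cone_tangent I V q) = local_dim I V P + 1" if "q \<in> P" for q
    using proj_class_torus[OF p(1)] that p(1,3) by (simp add: cdim_cone_tangent local_dim_torus)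
  moreover have "P \<notin> hyperplanes I"
  proof
    assume "P \<in> hyperplanes I"
    then obtain q where q: "q \<in> P" "(\<exists>k\<in>I. q k = 0) \<or> (\<Sum>k\<in>I. q k) = 0" by (auto simp: hyperplanes_def)
    then obtain t where "t \<noteq> 0" "q = (\<lambda>k. t * p k)" unfolding p(3) proj_class_iff by blast
    moreover from this have "(\<Sum>k\<in>I. q k) = t * (\<Sum>k\<in>I. p k)" by (simp add: sum_distrib_left)
    ultimately show False using q(2) p(2) torus_nonzero[OF p(1)] by auto
  qed
  ultimately show "P \<in> smooth_points I V - hyperplanes I" by (auto simp: smooth_points_def)
qed

end

section \<open>Genericity\<close>

lemma for_genericI:
  assumes "f \<in> polyfun I" "\<exists>u\<in>cspace I. f u \<noteq> 0" "\<And>u. u \<in> cspace I \<Longrightarrow> f u \<noteq> 0 \<Longrightarrow> Q u"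
  shows "for_generic I Q"
proof -
  obtain F where "F \<in> polys I" "\<forall>x. f x = peval F x" using polyfun_imp_peval[OF assms(1)] by blast
  moreover from this assms(2) have "F \<noteq> 0" by auto
  ultimately show ?thesis unfolding for_generic_def using assms(3) by auto
qed

lemma for_genericE:
  assumes "finite I" "for_generic I Q"
  obtains f where "f \<in> polyfun I" "\<exists>u\<in>cspace I. f u \<noteq> 0" "\<And>u. u \<in> cspace I \<Longrightarrow> f u \<noteq> 0 \<Longrightarrow> Q u"
proof -
  obtain F where "F \<in> polys I" "F \<noteq> 0" "\<forall>u\<in>cspace I. peval F u \<noteq> 0 \<longrightarrow> Q u"
    using assms(2) unfolding for_generic_def by blast
  then show ?thesis using that[of "peval F"] peval_polyfun peval_nonvanishing[OF assms(1)] by blast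
qed

lemma for_generic_mono:
  "for_generic I Q \<Longrightarrow> (\<And>u. u \<in> cspace I \<Longrightarrow> Q u \<Longrightarrow> Q' u) \<Longrightarrow> for_generic I Q'"
  unfolding for_generic_def by blast

lemma for_generic_ball:
  assumes I: "finite I" and A: "finite A" and Q: "\<And>a. a \<in> A \<Longrightarrow> for_generic I (Q a)"
  shows "for_generic I (\<lambda>u. \<forall>a\<in>A. Q a u)"
proof -
  have "\<forall>a\<in>A. \<exists>f. f \<in> polyfun I \<and> (\<exists>u\<in>cspace I. f u \<noteq> 0) \<and> (\<forall>u\<in>cspace I. f u \<noteq> 0 \<longrightarrow> Q a u)"
    using for_genericE[OF I Q] by metis
  then obtain f where f: "\<And>a. a \<in> A \<Longrightarrow> f a \<in> polyfun I" "\<And>a. a \<in> A \<Longrightarrow> \<exists>u\<in>cspace I. f a u \<noteq> 0"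
    "\<And>a u. a \<in> A \<Longrightarrow> u \<in> cspace I \<Longrightarrow> f a u \<noteq> 0 \<Longrightarrow> Q a u" by metis
  show ?thesis
  proof (rule for_genericI)
    show "(\<lambda>u. \<Prod>a\<in>A. f a u) \<in> polyfun I" using f(1) by (rule polyfun_prod)
    show "\<exists>u\<in>cspace I. (\<Prod>a\<in>A. f a u) \<noteq> 0" by (rule polyfun_prod_nonvanishing[OF A f(1,2)])
    show "\<forall>a\<in>A. Q a u" if "u \<in> cspace I" "(\<Prod>a\<in>A. f a u) \<noteq> 0" for u
      using that f(3) A by (auto simp: prod_zero_iff)
  qed
qed

lemma for_generic_conj:
  assumes "finite I" "for_generic I Q" "for_generic I Q'"
  shows "for_generic I (\<lambda>u. Q u \<and> Q' u)"
proof -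
  have "for_generic I (\<lambda>u. \<forall>b\<in>UNIV. if b then Q u else Q' u)"
  proof (rule for_generic_ball[OF assms(1)])
    show "for_generic I (\<lambda>u. if b then Q u else Q' u)" for b
      using assms by (cases b) simp_all
  qed simp
  then show ?thesis by (rule for_generic_mono) (auto split: if_splits)
qed

lemma for_generic_nonzero:
  "f \<in> polyfun I \<Longrightarrow> u \<in> cspace I \<Longrightarrow> f u \<noteq> 0 \<Longrightarrow> for_generic I (\<lambda>u. f u \<noteq> 0)"
  by (rule for_genericI) auto

text \<open>Surjectivity of \<open>L\<close> keeps the pulled-back polynomial from vanishing
  identically.\<close>

lemma for_generic_pullback:
  assumes "finite J" "for_generic J Q"
    and L: "\<And>r. r \<in> J \<Longrightarrow> (\<lambda>u. L u r) \<in> polyfun I" "\<And>u. u \<in> cspace I \<Longrightarrow> L u \<in> cspace J"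
      "\<And>y. y \<in> cspace J \<Longrightarrow> \<exists>u\<in>cspace I. L u = y"
  shows "for_generic I (\<lambda>u. Q (L u))"
proof -
  obtain f where f: "f \<in> polyfun J" "\<exists>y\<in>cspace J. f y \<noteq> 0" "\<And>y. y \<in> cspace J \<Longrightarrow> f y \<noteq> 0 \<Longrightarrow> Q y"
    using for_genericE[OF assms(1,2)] by blast
  show ?thesis
  proof (rule for_genericI)
    show "(\<lambda>u. f (L u)) \<in> polyfun I" by (rule polyfun_compose[OF f(1) L(1)])
    show "\<exists>u\<in>cspace I. f (L u) \<noteq> 0" using f(2) L(3) by metis
  qed (use f(3) L(2) in auto)
qed

lemma for_generic_ex:
  assumes "finite I" "for_generic I Q"
  shows "\<exists>u\<in>cspace I. Q u"
  using for_genericE[OF assms] by metis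

text \<open>Two generic values for the number of critical points are both attained at some common
  \<open>u\<close>, hence equal.\<close>

lemma ml_degreeI:
  assumes "finite I"
    and "for_generic I (\<lambda>u. finite (critical_points I X u) \<and> card (critical_points I X u) = N)"
  shows "ml_degree I X = N"
  unfolding ml_degree_def
proof (rule the_equality, rule assms(2))
  fix N' assume "for_generic I (\<lambda>u. finite (critical_points I X u) \<and> card (critical_points I X u) = N')"
  from for_generic_ex[OF assms(1) for_generic_conj[OF assms(1) assms(2) this]] show "N' = N" by auto
qed

section \<open>The critical equation in one variable\<close>

lemma pderiv_sum: "pderiv (\<Sum>a\<in>A. f a) = (\<Sum>a\<in>A. pderiv (f a :: complex poly))"
  by (induction A rule: infinite_finite_induct) (auto simp: pderiv_add)

text \<open>Additivity of logarithmic derivatives \<open>f' / f = q / G\<close>, with the common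
  denominator cleared to stay among polynomials.\<close>

lemma log_deriv_prod:
  fixes G :: "complex poly"
  assumes "finite A" "\<And>a. a \<in> A \<Longrightarrow> pderiv (f a) * G = f a * q a"
  shows "pderiv (\<Prod>a\<in>A. f a) * G = (\<Prod>a\<in>A. f a) * (\<Sum>a\<in>A. q a)"
  using assms
proof (induction A)
  case (insert a A)
  have "pderiv (\<Prod>a\<in>insert a A. f a) * G
      = f a * (pderiv (\<Prod>a\<in>A. f a) * G) + (\<Prod>a\<in>A. f a) * (pderiv (f a) * G)"
    using insert.hyps by (simp add: pderiv_mult algebra_simps)
  also have "\<dots> = (\<Prod>a\<in>insert a A. f a) * (\<Sum>a\<in>insert a A. q a)"
    using insert by (simp add: algebra_simps)
  finally show ?case .
qed simp

lemma log_deriv_power: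
  fixes G :: "complex poly"
  assumes "pderiv f * G = f * q"
  shows "pderiv (f ^ e) * G = f ^ e * smult (of_nat e) q"
proof (induction e)
  case (Suc e)
  have "pderiv (f ^ Suc e) * G = f * (pderiv (f ^ e) * G) + f ^ e * (pderiv f * G)"
    by (simp add: pderiv_mult algebra_simps)
  also have "\<dots> = f ^ Suc e * smult (of_nat (Suc e)) q"
    unfolding Suc.IH assms by (simp add: smult_add_left algebra_simps)
  finally show ?case .
qed simp

lemma card_roots_rsquarefree:
  fixes p :: "complex poly"
  assumes "rsquarefree p"
  shows "card {z. poly p z = 0} = degree p"
proof -
  have "p \<noteq> 0" using assms by (auto simp: rsquarefree_def)
  then have "degree p = degree (\<Prod>z | poly p z = 0. [:- z, 1:])"
    by (subst (1) complex_poly_decompose_rsquarefree[OF assms, symmetric]) simp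
  also have "\<dots> = card {z. poly p z = 0}"
    by (subst degree_prod_eq_sum_degree) auto
  finally show ?thesis by simp
qed

text \<open>Nonzero constant terms keep 0 out of the root set; positive degree supplies a root,
  which makes \<open>R\<close> nonempty and \<open>K 1\<close> nonzero.\<close>

locale poly_family =
  fixes m :: nat and g :: "nat \<Rightarrow> complex poly"
  assumes m: "m \<ge> 1"
    and g0: "\<And>i. 1 \<le> i \<Longrightarrow> i \<le> m \<Longrightarrow> poly (g i) 0 \<noteq> 0"
    and deg: "\<And>i. 1 \<le> i \<Longrightarrow> i \<le> m \<Longrightarrow> degree (g i) > 0"
begin

definition R :: "complex set" where "R = {z. \<exists>i\<in>{1..m}. poly (g i) z = 0}"

definition G :: "complex poly" where "G = (\<Prod>r\<in>R. [:- r, 1:])"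

definition cofactor :: "complex \<Rightarrow> complex poly" where "cofactor r = (\<Prod>s\<in>R - {r}. [:- s, 1:])"

text \<open>The logarithmic derivative of \<open>g i\<close> is \<open>q i / G\<close>.\<close>

definition q :: "nat \<Rightarrow> complex poly" where
  "q i = (\<Sum>r\<in>R. smult (of_nat (order r (g i))) (cofactor r))"

lemma g_nonzero: "1 \<le> i \<Longrightarrow> i \<le> m \<Longrightarrow> g i \<noteq> 0"
  using g0 by fastforce

lemma finite_R: "finite R"
proof -
  have "R = (\<Union>i\<in>{1..m}. {z. poly (g i) z = 0})" by (auto simp: R_def)
  then show ?thesis using g_nonzero by (auto intro!: poly_roots_finite)
qed

lemma zero_notin_R: "0 \<notin> R"
  using g0 by (auto simp: R_def)

lemma G_factor: "r \<in> R \<Longrightarrow> G = [:- r, 1:] * cofactor r"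
  unfolding G_def cofactor_def by (rule prod.remove[OF finite_R])

lemma poly_G_0_iff: "poly G t = 0 \<longleftrightarrow> t \<in> R"
  using finite_R by (auto simp: G_def poly_prod prod_zero_iff)

lemma poly_cofactor_self: "poly (cofactor r) r \<noteq> 0"
  using finite_R by (auto simp: cofactor_def poly_prod prod_zero_iff)

lemma poly_cofactor_other: "r \<in> R \<Longrightarrow> s \<noteq> r \<Longrightarrow> poly (cofactor s) r = 0"
  using finite_R by (auto simp: cofactor_def poly_prod prod_zero_iff)

lemma degree_G: "degree G = card R"
  unfolding G_def by (subst degree_prod_eq_sum_degree) auto

lemma degree_cofactor: "r \<in> R \<Longrightarrow> degree (cofactor r) = card R - 1"
  unfolding cofactor_def using finite_R by (subst degree_prod_eq_sum_degree) auto

lemma lead_coeff_G: "coeff G (card R) = 1"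
  using lead_coeff_prod[of "\<lambda>r. [:- r, 1:]" R] by (simp add: degree_G flip: G_def)

lemma degree_q: "degree (q i) \<le> card R - 1"
  unfolding q_def by (intro degree_sum_le finite_R order.trans[OF degree_smult_le]) (simp add: degree_cofactor)

text \<open>Over the complex numbers \<open>g i\<close> splits into linear factors, and
  \<open>[:- r, 1:]\<close> has logarithmic derivative \<open>cofactor r / G\<close>.\<close>

lemma log_deriv_g:
  assumes "1 \<le> i" "i \<le> m"
  shows "pderiv (g i) * G = g i * q i"
proof -
  let ?P = "\<Prod>r\<in>R. [:- r, 1:] ^ order r (g i)"
  \<comment> \<open>Points of \<open>R\<close> that are not roots of \<open>g i\<close> have order 0
    and contribute the factor 1.\<close>
  have "(\<Prod>r | poly (g i) r = 0. [:- r, 1:] ^ order r (g i)) = ?P"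
    using assms finite_R by (intro prod.mono_neutral_left) (auto simp: R_def order_root intro!: bexI[of _ i])
  then have g: "g i = smult (lead_coeff (g i)) ?P"
    using complex_poly_decompose[of "g i"] by simp
  have "pderiv ?P * G = ?P * q i"
    unfolding q_def
    by (intro log_deriv_prod finite_R log_deriv_power) (simp add: G_factor pderiv_pCons)
  then have "smult (lead_coeff (g i)) (pderiv ?P * G) = smult (lead_coeff (g i)) (?P * q i)" by simp
  then show ?thesis by (subst (1 2) g) (simp add: pderiv_smult)
qed

text \<open>The logarithmic derivative \<open>q i / G\<close> has a simple pole at each root of
  \<open>g i\<close>, with the multiplicity as residue: only the summand of \<open>r\<close>
  survives at \<open>r\<close>.\<close>

lemma poly_q_root:
  assumes "1 \<le> i" "i \<le> m" "poly (g i) r = 0"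
  shows "poly (q i) r \<noteq> 0"
proof -
  have r: "r \<in> R" using assms by (auto simp: R_def)
  have "poly (q i) r = (\<Sum>s\<in>R. if s = r then of_nat (order r (g i)) * poly (cofactor r) r else 0)"
    unfolding q_def poly_sum using poly_cofactor_other[OF r] by (intro sum.cong) auto
  also have "\<dots> = of_nat (order r (g i)) * poly (cofactor r) r" using r finite_R by simp
  finally show ?thesis
    using poly_cofactor_self[of r] assms g_nonzero by (simp add: order_root)
qed

text \<open>\<open>G\<close> times the difference of the two sides of \<open>y 0 = (\<Sum>i. y i * t * g i' (t) / g i (t))\<close>.\<close>

definition h :: "(nat \<Rightarrow> complex) \<Rightarrow> complex poly" where
  "h y = smult (y 0) G - [:0, 1:] * (\<Sum>i=1..m. smult (y i) (q i))"

lemma h_eq: "h y = smult (y 0) G - (\<Sum>i=1..m. smult (y i) ([:0, 1:] * q i))"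
  unfolding h_def by (simp add: sum_distrib_left del: mult_pCons_left)

lemma poly_h: "poly (h y) t = y 0 * poly G t - t * (\<Sum>i=1..m. y i * poly (q i) t)"
  by (simp add: h_def poly_sum)

lemma poly_pderiv_h:
  "poly (pderiv (h y)) t = y 0 * poly (pderiv G) t -
     (\<Sum>i=1..m. y i * poly (pderiv ([:0, 1:] * q i)) t)"
  unfolding h_eq by (simp add: pderiv_diff pderiv_smult pderiv_sum poly_sum del: mult_pCons_left)

lemma card_R: "card R \<ge> 1"
proof -
  have "\<not> constant (poly (g 1))" using deg[of 1] m by (simp add: constant_degree)
  then obtain z where "poly (g 1) z = 0" using fundamental_theorem_of_algebra by blast
  then have "z \<in> R" using m by (auto simp: R_def)
  then show ?thesis using finite_R by (auto simp: Suc_le_eq card_gt_0_iff)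
qed

lemma degree_h: "degree (h y) \<le> card R"
  unfolding h_def
proof (rule degree_diff_le)
  show "degree (smult (y 0) G) \<le> card R" using degree_smult_le[of "y 0" G] by (simp add: degree_G)
  have "degree (\<Sum>i=1..m. smult (y i) (q i)) \<le> card R - 1"
    by (intro degree_sum_le order.trans[OF degree_smult_le] degree_q) auto
  then have "degree [:0, 1::complex:] + degree (\<Sum>i=1..m. smult (y i) (q i)) \<le> card R"
    using card_R by simp
  then show "degree ([:0, 1:] * (\<Sum>i=1..m. smult (y i) (q i))) \<le> card R"
    by (rule order.trans[OF degree_mult_le])
qed

lemma coeff_h: "coeff (h y) k = y 0 * coeff G k - (\<Sum>i=1..m. y i * coeff ([:0, 1:] * q i) k)"
  unfolding h_eq by (simp add: coeff_sum del: mult_pCons_left)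

lemma h_polyfun: "(\<lambda>y. poly (h y) t) \<in> polyfun {0..m}"
  unfolding poly_h by (intro polyfun_intros) auto

text \<open>The derivative of \<open>h y / G\<close> is \<open>- (\<Sum>i. y i * K i) / G\<^sup>2\<close>.\<close>

definition K :: "nat \<Rightarrow> complex poly" where
  "K i = G * pderiv ([:0, 1:] * q i) - pderiv G * ([:0, 1:] * q i)"

text \<open>Eliminates \<open>y 0\<close> from the two equations for a double root.\<close>

lemma K_sum:
  assumes "poly (h y) t = 0" "poly (pderiv (h y)) t = 0"
  shows "(\<Sum>i=1..m. y i * poly (K i) t) = 0"
proof -
  have "(\<Sum>i=1..m. y i * poly (K i) t) =
    poly G t * (\<Sum>i=1..m. y i * poly (pderiv ([:0, 1:] * q i)) t) -
    poly (pderiv G) t * (t * (\<Sum>i=1..m. y i * poly (q i) t))"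
    unfolding K_def by (simp add: sum_distrib_left sum_subtractf algebra_simps del: mult_pCons_left)
  also have "\<dots> = poly G t * (y 0 * poly (pderiv G) t) - poly (pderiv G) t * (y 0 * poly G t)"
    using assms unfolding poly_h poly_pderiv_h by simp
  finally show ?thesis by simp
qed

text \<open>At a root of \<open>g 1\<close> the polynomial \<open>G\<close> vanishes to first order
  only, so the second term of \<open>K 1\<close> survives as a product of nonzero factors.\<close>

lemma K1_nonzero: "K 1 \<noteq> 0"
proof -
  have "\<not> constant (poly (g 1))" using deg[of 1] m by (simp add: constant_degree)
  then obtain z where z: "poly (g 1) z = 0" using fundamental_theorem_of_algebra by blast
  then have zR: "z \<in> R" using m by (auto simp: R_def)
  have "poly (pderiv G) z = poly (cofactor z) z"
    unfolding G_factor[OF zR] pderiv_mult by (simp add: pderiv_pCons)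
  then have "poly (K 1) z = - (poly (cofactor z) z * (z * poly (q 1) z))"
    using zR by (simp add: K_def poly_G_0_iff)
  moreover have "poly (q 1) z \<noteq> 0" using poly_q_root[of 1 z] z m by simp
  moreover have "z \<noteq> 0" using zR zero_notin_R by blast
  ultimately have "poly (K 1) z \<noteq> 0" using poly_cofactor_self by simp
  then show ?thesis by auto
qed

text \<open>The data \<open>y\<close> for which \<open>h y\<close> has a double root depend polynomially on only \<open>m\<close> parameters: the
  root \<open>x 1\<close>, and \<open>y 2, \<dots>, y m\<close> divided by a common denominator.\<close>

lemma generic_no_double_root:
  "for_generic {0..m} (\<lambda>y. \<forall>t. t \<notin> R \<longrightarrow> poly (K 1) t \<noteq> 0 \<longrightarrow>
     \<not> (poly (h y) t = 0 \<and> poly (pderiv (h y)) t = 0))"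
proof -
  \<comment> \<open>With \<open>y i = x i * K 1 * G\<close> for \<open>i \<ge> 2\<close>, all
    evaluated at the double root \<open>x 1\<close>, the equation of \<open>K_sum\<close> gives
    \<open>y 1\<close> and then the vanishing of \<open>h y\<close> gives \<open>y 0\<close>. The
    factor \<open>K 1\<close> cancels in the first division and \<open>G\<close> in the second, so
    the formulas are polynomial.\<close>
  define \<psi> :: "nat \<Rightarrow> (nat \<Rightarrow> complex) \<Rightarrow> complex" where "\<psi> = (\<lambda>r x.
    if r = 0 then x 1 * (\<Sum>i=2..m. x i * (poly (K 1) (x 1) * poly (q i) (x 1) - poly (K i) (x 1) * poly (q 1) (x 1)))
    else if r = 1 then - (\<Sum>i=2..m. x i * (poly (K i) (x 1) * poly G (x 1)))
    else x r * (poly (K 1) (x 1) * poly G (x 1)))"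
  have "\<psi> r \<in> polyfun {1..m}" if "r \<in> {0..m}" for r
  proof -
    consider "r = 0" | "r = 1" | "r \<ge> 2" by linarith
    then show ?thesis
    proof cases
      case 1
      show ?thesis unfolding \<psi>_def if_P[OF 1] using m by (intro polyfun_intros) auto
    next
      case 2
      then have "\<psi> r = (\<lambda>x. - (\<Sum>i=2..m. x i * (poly (K i) (x 1) * poly G (x 1))))" by (simp add: \<psi>_def)
      then show ?thesis using m by (auto intro!: polyfun_intros)
    next
      case 3
      then have "\<psi> r = (\<lambda>x. x r * (poly (K 1) (x 1) * poly G (x 1)))" by (simp add: \<psi>_def)
      then show ?thesis using m that 3 by (auto intro!: polyfun_intros)
    qed
  qed
  then have "\<exists>F\<in>polys {0..m}. F \<noteq> 0 \<and> (\<forall>x. peval F (\<lambda>r. \<psi> r x) = 0)"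
    by (intro algebraic_dependence[of "{1..m}"]) auto
  then obtain F where F: "F \<in> polys {0..m}" "F \<noteq> 0" "\<And>x. peval F (\<lambda>r. \<psi> r x) = 0" by blast
  have "peval F y = 0" if t: "t \<notin> R" "poly (K 1) t \<noteq> 0" "poly (h y) t = 0" "poly (pderiv (h y)) t = 0" for y t
  proof -
    have Gt: "poly G t \<noteq> 0" using t(1) by (simp add: poly_G_0_iff)
    define b where "b = poly (K 1) t * poly G t"
    have b: "b \<noteq> 0" using Gt t(2) by (simp add: b_def)
    define x where "x = (\<lambda>i. if i = 1 then t else y i / b)"
    have x1: "x 1 = t" and xi: "\<And>i. i \<in> {2..m} \<Longrightarrow> x i = y i / b" by (auto simp: x_def)
    have split: "(\<Sum>i=1..m. f i) = f 1 + (\<Sum>i=2..m. f i)" for f :: "nat \<Rightarrow> complex"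
      using sum.atLeast_Suc_atMost[OF m, of f] by (simp add: numeral_2_eq_2)
    have y1: "y 1 * poly (K 1) t = - (\<Sum>i=2..m. y i * poly (K i) t)"
      using K_sum[OF t(3,4)] unfolding split by (simp add: eq_neg_iff_add_eq_0)
    have sumK: "(\<Sum>i=2..m. x i * (poly (K i) t * poly G t)) = - y 1"
    proof -
      have "(\<Sum>i=2..m. x i * (poly (K i) t * poly G t)) = (\<Sum>i=2..m. y i * poly (K i) t) * (poly G t / b)"
        unfolding sum_distrib_right by (intro sum.cong) (auto simp: xi)
      also have "\<dots> = - (y 1 * poly (K 1) t) * (poly G t / b)" using y1 by simp
      also have "\<dots> = - y 1" using Gt t(2) by (simp add: b_def)
      finally show ?thesis .
    qed
    have y0: "y 0 * poly G t = t * (\<Sum>i=1..m. y i * poly (q i) t)"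
      using t(3) by (simp add: poly_h)
    have "(\<Sum>i=2..m. x i * (poly (K 1) t * poly (q i) t - poly (K i) t * poly (q 1) t)) * poly G t =
        (\<Sum>i=2..m. y i * poly (q i) t) - poly (q 1) t * (\<Sum>i=2..m. x i * (poly (K i) t * poly G t))"
    proof -
      have "x i * (poly (K 1) t * poly (q i) t - poly (K i) t * poly (q 1) t) * poly G t
        = y i * poly (q i) t - poly (q 1) t * (x i * (poly (K i) t * poly G t))" if "i \<in> {2..m}" for i
      proof -
        have "y i = x i * (poly (K 1) t * poly G t)" using b unfolding b_def[symmetric] by (simp add: xi[OF that])
        then show ?thesis by (simp add: algebra_simps)
      qed
      then show ?thesis unfolding sum_distrib_right sum_distrib_left sum_subtractf[symmetric]
        by (intro sum.cong) auto
    qed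
    also have "\<dots> = (\<Sum>i=1..m. y i * poly (q i) t)"
      unfolding sumK split by (simp add: algebra_simps)
    finally have "t * (\<Sum>i=2..m. x i * (poly (K 1) t * poly (q i) t - poly (K i) t * poly (q 1) t)) * poly G t =
        y 0 * poly G t"
      using y0 by (simp add: mult.assoc)
    then have y0': "t * (\<Sum>i=2..m. x i * (poly (K 1) t * poly (q i) t - poly (K i) t * poly (q 1) t)) = y 0"
      using Gt by simp
    have "y r = \<psi> r x" if "r \<in> {0..m}" for r
    proof -
      consider "r = 0" | "r = 1" | "2 \<le> r" by linarith
      then show ?thesis
      proof cases
        case 1
        then show ?thesis by (simp only: \<psi>_def x1 y0' if_True simp_thms)
      next
        case 2
        then show ?thesis unfolding \<psi>_def x1 sumK by simp
      next
        case 3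
        then show ?thesis unfolding \<psi>_def x1 b_def[symmetric] using b that by (simp add: xi)
      qed
    qed
    then show ?thesis using polyfun_cong[OF peval_polyfun[OF F(1)], of y "\<lambda>r. \<psi> r x"] F(3) by simp
  qed
  then show ?thesis unfolding for_generic_def using F(1,2) by blast
qed

text \<open>Nonzero \<open>y i\<close> with \<open>i \<ge> 1\<close> keep the critical points in the
  torus, and \<open>y 0 \<noteq> 0\<close> keeps 0 from being a root of \<open>h y\<close>. The sum
  is the total of the data, by which the critical equations are divided.\<close>

definition admissible :: "(nat \<Rightarrow> complex) \<Rightarrow> bool" where
  "admissible y \<longleftrightarrow> (\<forall>i\<in>{0..m}. y i \<noteq> 0) \<and> (\<Sum>i=1..m. y i) \<noteq> 0 \<and>
     (\<forall>t\<in>R. poly (h y) t \<noteq> 0) \<and> card {t. poly (h y) t = 0} = card R"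

lemma generic_admissible: "for_generic {0..m} admissible"
proof -
  \<comment> \<open>Unit vectors isolate the summands of \<open>h\<close>: index 0 gives
    \<open>G\<close>, which is nonzero off \<open>R\<close>, and index \<open>i\<close> gives
    \<open>- t * q i\<close>, which is nonzero at the roots of \<open>g i\<close>.\<close>
  let ?e = "\<lambda>i j :: nat. if j = i then 1 else (0 :: complex)"
  have e: "?e i \<in> cspace {0..m}" if "i \<le> m" for i using that by (auto simp: cspace_def)
  have h_e0: "poly (h (?e 0)) t = poly G t" for t
    by (auto simp: poly_h intro!: sum.neutral)
  have h_e: "poly (h (?e i)) t = - t * poly (q i) t" if "1 \<le> i" "i \<le> m" for i t
  proof -
    have "(\<Sum>j=1..m. ?e i j * poly (q j) t) = (\<Sum>j=1..m. if j = i then poly (q i) t else 0)"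
      by (intro sum.cong) auto
    then show ?thesis using that by (simp add: poly_h)
  qed
  have 1: "for_generic {0..m} (\<lambda>y. \<forall>i\<in>{0..m}. y i \<noteq> 0)"
    by (intro for_generic_ball for_generic_nonzero[OF _ e] polyfun.coord) auto
  have 2: "for_generic {0..m} (\<lambda>y. (\<Sum>i=1..m. y i) \<noteq> 0)"
  proof (rule for_generic_nonzero[OF _ e[OF m]])
    show "(\<lambda>y. \<Sum>i=1..m. y i) \<in> polyfun {0..m}" by (intro polyfun_intros) auto
    show "(\<Sum>i=1..m. ?e 1 i) \<noteq> 0" using m by simp
  qed
  have 3: "for_generic {0..m} (\<lambda>y. \<forall>t\<in>R. poly (h y) t \<noteq> 0)"
  proof (rule for_generic_ball[OF _ finite_R])
    fix t assume t: "t \<in> R"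
    then obtain i where i: "1 \<le> i" "i \<le> m" "poly (g i) t = 0" by (auto simp: R_def)
    have "poly (h (?e i)) t \<noteq> 0"
      using h_e[OF i(1,2)] poly_q_root[OF i] t zero_notin_R by auto
    then show "for_generic {0..m} (\<lambda>y. poly (h y) t \<noteq> 0)"
      by (rule for_generic_nonzero[OF h_polyfun e[OF i(2)]])
  qed simp
  \<comment> \<open>\<open>generic_no_double_root\<close> says nothing at the zeros of
    \<open>K 1\<close>. They are finitely many, so \<open>h y\<close> can be required to be nonzero
    there.\<close>
  have 4: "for_generic {0..m} (\<lambda>y. \<forall>t\<in>{t. poly (K 1) t = 0} - R. poly (h y) t \<noteq> 0)"
  proof (rule for_generic_ball)
    show "finite ({t. poly (K 1) t = 0} - R)" using poly_roots_finite[OF K1_nonzero] by simp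
    fix t assume t: "t \<in> {t. poly (K 1) t = 0} - R"
    have "poly (h (?e 0)) t \<noteq> 0" unfolding h_e0 using t by (simp add: poly_G_0_iff)
    then show "for_generic {0..m} (\<lambda>y. poly (h y) t \<noteq> 0)"
      by (rule for_generic_nonzero[OF h_polyfun e[OF le0]])
  qed simp
  \<comment> \<open>This makes the degree of \<open>h y\<close> exactly \<open>card R\<close>, so
    that a squarefree \<open>h y\<close> has that many roots.\<close>
  have 5: "for_generic {0..m} (\<lambda>y. coeff (h y) (card R) \<noteq> 0)"
  proof (rule for_generic_nonzero[OF _ e[OF le0]])
    show "(\<lambda>y. coeff (h y) (card R)) \<in> polyfun {0..m}"
      unfolding coeff_h by (intro polyfun_intros) auto
    have "h (?e 0) = G" unfolding h_def by simp
    then show "coeff (h (?e 0)) (card R) \<noteq> 0" by (simp add: lead_coeff_G)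
  qed
  have "for_generic {0..m} (\<lambda>y. ((\<forall>i\<in>{0..m}. y i \<noteq> 0) \<and> (\<Sum>i=1..m. y i) \<noteq> 0) \<and>
      ((\<forall>t\<in>R. poly (h y) t \<noteq> 0) \<and> (\<forall>t\<in>{t. poly (K 1) t = 0} - R. poly (h y) t \<noteq> 0)) \<and>
      coeff (h y) (card R) \<noteq> 0 \<and> (\<forall>t. t \<notin> R \<longrightarrow> poly (K 1) t \<noteq> 0 \<longrightarrow>
     \<not> (poly (h y) t = 0 \<and> poly (pderiv (h y)) t = 0)))"
    by (intro for_generic_conj 1 2 3 4 5 generic_no_double_root finite_atLeastAtMost)
  then show ?thesis
  proof (rule for_generic_mono)
    fix y assume y: "((\<forall>i\<in>{0..m}. y i \<noteq> 0) \<and> (\<Sum>i=1..m. y i) \<noteq> 0) \<and>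
      ((\<forall>t\<in>R. poly (h y) t \<noteq> 0) \<and> (\<forall>t\<in>{t. poly (K 1) t = 0} - R. poly (h y) t \<noteq> 0)) \<and>
      coeff (h y) (card R) \<noteq> 0 \<and> (\<forall>t. t \<notin> R \<longrightarrow> poly (K 1) t \<noteq> 0 \<longrightarrow>
     \<not> (poly (h y) t = 0 \<and> poly (pderiv (h y)) t = 0))"
    have "rsquarefree (h y)" unfolding rsquarefree_roots using y by blast
    moreover have "h y \<noteq> 0" using y by auto
    ultimately have "card {t. poly (h y) t = 0} = degree (h y)"
      by (simp add: card_roots_rsquarefree)
    also have "degree (h y) = card R"
      using y degree_h[of y] le_degree[of "h y" "card R"] by linarith
    finally show "admissible y" using y unfolding admissible_def by blast
  qed
qed

text \<open>On \<open>R\<close> both sides fail by admissibility. Elsewhere multiplication by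
  \<open>G\<close> relates the equations, and a root is nonzero because \<open>h y\<close> takes the
  value \<open>y 0 * poly G 0\<close> at 0.\<close>

lemma critical_equation_iff:
  assumes "admissible y"
  shows "t \<noteq> 0 \<and> (\<forall>i\<in>{1..m}. poly (g i) t \<noteq> 0) \<and>
      y 0 = (\<Sum>i=1..m. y i * (t * poly (pderiv (g i)) t / poly (g i) t)) \<longleftrightarrow> poly (h y) t = 0"
proof (cases "t \<in> R")
  case True
  then show ?thesis using assms by (auto simp: admissible_def R_def)
next
  case False
  then have g: "poly (g i) t \<noteq> 0" if "i \<in> {1..m}" for i using that by (auto simp: R_def)
  have Gt: "poly G t \<noteq> 0" using False by (simp add: poly_G_0_iff)
  have "poly (pderiv (g i)) t / poly (g i) t = poly (q i) t / poly G t" if "i \<in> {1..m}" for i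
  proof -
    have "poly (pderiv (g i)) t * poly G t = poly (g i) t * poly (q i) t"
      using log_deriv_g[of i] that by (metis atLeastAtMost_iff poly_mult)
    then show ?thesis using g[OF that] Gt by (simp add: frac_eq_eq mult.commute)
  qed
  then have "(\<Sum>i=1..m. y i * (t * poly (pderiv (g i)) t / poly (g i) t)) =
      (\<Sum>i=1..m. t * (y i * poly (q i) t) / poly G t)"
    by (intro sum.cong refl) (metis (no_types, lifting) mult.left_commute times_divide_eq_right)
  also have "\<dots> = t * (\<Sum>i=1..m. y i * poly (q i) t) / poly G t"
    by (simp add: sum_distrib_left sum_divide_distrib)
  finally have sum: "(\<Sum>i=1..m. y i * (t * poly (pderiv (g i)) t / poly (g i) t)) =
      t * (\<Sum>i=1..m. y i * poly (q i) t) / poly G t" .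
  have eq: "y 0 = (\<Sum>i=1..m. y i * (t * poly (pderiv (g i)) t / poly (g i) t)) \<longleftrightarrow> poly (h y) t = 0"
    unfolding sum poly_h using Gt by (simp add: eq_divide_eq)
  have "poly (h y) 0 \<noteq> 0" using assms zero_notin_R by (simp add: poly_h poly_G_0_iff admissible_def)
  then show ?thesis using eq g by auto
qed

end

section \<open>Critical points of the likelihood function\<close>

lemma powr_line_deriv:
  "((\<lambda>t. (1 + t * a) powr e) has_field_derivative e * a) (at (0::complex))"
proof -
  have "((\<lambda>t. 1 + t * a) has_field_derivative a) (at 0)" by (auto intro!: derivative_eq_intros)
  moreover have "((\<lambda>z. z powr e) has_field_derivative e * 1 powr (e - 1)) (at (1 + 0 * a))"
    using has_field_derivative_powr[of 1 e] by simp
  ultimately show ?thesis using DERIV_chain2[where f = "\<lambda>z. z powr e"] by fastforce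
qed

lemma DERIV_prod_at_1:
  assumes "finite A" "\<And>a. a \<in> A \<Longrightarrow> (f a has_field_derivative D a) (at (0::complex))" "\<And>a. a \<in> A \<Longrightarrow> f a 0 = 1"
  shows "((\<lambda>t. \<Prod>a\<in>A. f a t :: complex) has_field_derivative (\<Sum>a\<in>A. D a)) (at 0)"
  using assms
proof (induction A)
  case (insert a A)
  then have "((\<lambda>t. f a t * (\<Prod>a\<in>A. f a t)) has_field_derivative
      D a * (\<Prod>a\<in>A. f a 0) + (\<Sum>a\<in>A. D a) * f a 0) (at 0)"
    by (intro DERIV_mult) auto
  then show ?case using insert by simp
qed simp

text \<open>The normalised branch has value 1 at \<open>p\<close>, so its derivative there equals
  its logarithmic derivative, a sum over the factors.\<close>

lemma likelihood_deriv:
  assumes "finite I" "\<And>k. k \<in> I \<Longrightarrow> p k \<noteq> 0" "(\<Sum>k\<in>I. p k) \<noteq> 0"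
  shows "((\<lambda>t. likelihood_at I u p (\<lambda>k. p k + t * v k)) has_field_derivative
      (\<Sum>k\<in>I. u k * (v k / p k)) - (\<Sum>k\<in>I. u k) * ((\<Sum>k\<in>I. v k) / (\<Sum>k\<in>I. p k))) (at 0)"
proof -
  have eq: "likelihood_at I u p (\<lambda>k. p k + t * v k) =
    (\<Prod>k\<in>I. (1 + t * (v k / p k)) powr u k) /
      (1 + t * ((\<Sum>k\<in>I. v k) / (\<Sum>k\<in>I. p k))) powr (\<Sum>k\<in>I. u k)" for t
  proof -
    have "(\<Prod>k\<in>I. ((p k + t * v k) / p k) powr u k) = (\<Prod>k\<in>I. (1 + t * (v k / p k)) powr u k)"
      using assms(2) by (intro prod.cong) (auto simp: add_divide_distrib)
    moreover have "(\<Sum>k\<in>I. p k + t * v k) / (\<Sum>k\<in>I. p k) = 1 + t * ((\<Sum>k\<in>I. v k) / (\<Sum>k\<in>I. p k))"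
      using assms(3) by (simp add: sum.distrib sum_distrib_left[symmetric] add_divide_distrib)
    ultimately show ?thesis unfolding likelihood_at_def by simp
  qed
  have "((\<lambda>t. \<Prod>k\<in>I. (1 + t * (v k / p k)) powr u k) has_field_derivative
      (\<Sum>k\<in>I. u k * (v k / p k))) (at 0)"
    by (intro DERIV_prod_at_1 assms(1) powr_line_deriv) simp
  from DERIV_divide[OF this powr_line_deriv[of "(\<Sum>k\<in>I. v k) / (\<Sum>k\<in>I. p k)" "\<Sum>k\<in>I. u k"]]
  show ?thesis unfolding eq by simp
qed

section \<open>Likelihood equations and their solutions\<close>

context scroll
begin

abbreviation g :: "nat \<Rightarrow> complex poly" where "g \<equiv> scroll_poly n c"

lemma poly_g: "poly (g i) t = (\<Sum>j\<le>n i. c i j * t ^ j)"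
  by (simp add: scroll_poly_def poly_sum poly_monom atLeast0AtMost)

lemma poly_pderiv_g: "t * poly (pderiv (g i)) t = (\<Sum>j\<le>n i. of_nat j * (c i j * t ^ j))"
  unfolding scroll_poly_def pderiv_sum poly_sum sum_distrib_left atLeast0AtMost
proof (intro sum.cong refl)
  fix j
  show "t * poly (pderiv (monom (c i j) j)) t = of_nat j * (c i j * t ^ j)"
    by (cases j) (simp_all add: pderiv_monom poly_monom)
qed

lemma coeff_g: "coeff (g i) j = (if j \<le> n i then c i j else 0)"
  by (simp add: scroll_poly_def coeff_sum)

sublocale roots: poly_family m g
proof
  fix i assume i: "1 \<le> i" "i \<le> m"
  have "poly (g i) 0 = c i 0" by (simp add: poly_0_coeff_0 coeff_g)
  then show "poly (g i) 0 \<noteq> 0" using c i by simp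
  have "coeff (g i) (n i) \<noteq> 0" using c i by (simp add: coeff_g)
  then show "degree (g i) > 0" using n[OF i] le_degree by fastforce
qed (rule m)

text \<open>The sufficient statistics of the model: \<open>L u 0\<close> is the last row of the
  matrix applied to \<open>u\<close>, and the block sums carry the same information as the other
  rows together with the row of ones belonging to \<open>s\<close>.\<close>

definition L :: "(nat \<times> nat \<Rightarrow> complex) \<Rightarrow> nat \<Rightarrow> complex" where
  "L u r = (if r = 0 then \<Sum>(i, j)\<in>I. of_nat j * u (i, j)
     else if r \<le> m then \<Sum>j\<le>n r. u (r, j) else 0)"

lemma sum_u: "(\<Sum>k\<in>I. u k) = (\<Sum>i=1..m. L u i)"
  unfolding sum_I by (intro sum.cong) (auto simp: L_def)

text \<open>Pairs a weight with a tangent direction; it is used both for the data \<open>u\<close>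
  and for the point \<open>p\<close>.\<close>

lemma sum_tangent:
  "(\<Sum>(i, j)\<in>I. w (i, j) * (\<alpha> i + of_nat j * \<beta>)) = (\<Sum>i=1..m. \<alpha> i * L w i) + \<beta> * L w 0"
proof -
  have "(\<Sum>(i, j)\<in>I. w (i, j) * (\<alpha> i + of_nat j * \<beta>)) =
      (\<Sum>(i, j)\<in>I. w (i, j) * \<alpha> i) + \<beta> * (\<Sum>(i, j)\<in>I. of_nat j * w (i, j))"
    unfolding sum_distrib_left sum.distrib[symmetric]
    by (intro sum.cong) (auto simp: algebra_simps)
  also have "(\<Sum>(i, j)\<in>I. w (i, j) * \<alpha> i) = (\<Sum>i=1..m. \<alpha> i * L w i)"
    unfolding sum_I by (intro sum.cong) (auto simp: L_def sum_distrib_left mult.commute)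
  finally show ?thesis by (simp add: L_def)
qed

lemma L_pt: "i \<in> {1..m} \<Longrightarrow> L (pt l t) i = l i * poly (g i) t"
  by (auto simp: L_def poly_g sum_distrib_left pt_apply I_iff mult_ac intro!: sum.cong)

lemma L_pt_0: "L (pt l t) 0 = (\<Sum>i=1..m. l i * (t * poly (pderiv (g i)) t))"
  unfolding L_def poly_pderiv_g sum_I
  by (auto simp: sum_distrib_left pt_apply I_iff mult_ac intro!: sum.cong)

text \<open>The derivative is linear in \<open>\<alpha>\<close> and \<open>\<beta>\<close>, so it
  vanishes on the tangent space iff each coefficient does. The result is the likelihood equations:
  the statistics of \<open>u\<close> and \<open>p\<close> are proportional.\<close>

lemma critical_at_torus:
  assumes p: "p \<in> torus" and s: "(\<Sum>k\<in>I. p k) \<noteq> 0"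
  shows "(\<forall>v\<in>cone_tangent I V p.
      ((\<lambda>t. likelihood_at I u p (\<lambda>k. p k + t * v k)) has_field_derivative 0) (at 0)) \<longleftrightarrow>
    (\<forall>r\<in>{0..m}. L u r * (\<Sum>k\<in>I. p k) = (\<Sum>k\<in>I. u k) * L p r)"
proof -
  let ?s = "\<Sum>k\<in>I. p k" and ?U = "\<Sum>k\<in>I. u k"
  have iff: "((\<lambda>t. likelihood_at I u p (\<lambda>k. p k + t * tangent p \<alpha> \<beta> k)) has_field_derivative 0) (at 0)
    \<longleftrightarrow> (\<Sum>i=1..m. \<alpha> i * (L u i * ?s - ?U * L p i)) + \<beta> * (L u 0 * ?s - ?U * L p 0) = 0" for \<alpha> \<beta>
  proof -
    have "(\<Sum>k\<in>I. u k * (tangent p \<alpha> \<beta> k / p k)) = (\<Sum>(i, j)\<in>I. u (i, j) * (\<alpha> i + of_nat j * \<beta>))"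
      using torus_nonzero[OF p] by (intro sum.cong) (auto simp: tangent_def)
    moreover have "(\<Sum>k\<in>I. tangent p \<alpha> \<beta> k) = (\<Sum>(i, j)\<in>I. p (i, j) * (\<alpha> i + of_nat j * \<beta>))"
      by (intro sum.cong) (auto simp: tangent_def)
    ultimately have "((\<lambda>t. likelihood_at I u p (\<lambda>k. p k + t * tangent p \<alpha> \<beta> k)) has_field_derivative
        ((\<Sum>i=1..m. \<alpha> i * L u i) + \<beta> * L u 0) - ?U * (((\<Sum>i=1..m. \<alpha> i * L p i) + \<beta> * L p 0) / ?s)) (at 0)"
      using likelihood_deriv[OF finite_I torus_nonzero[OF p] s, of u "tangent p \<alpha> \<beta>"]
      by (simp only: sum_tangent)
    then have "((\<lambda>t. likelihood_at I u p (\<lambda>k. p k + t * tangent p \<alpha> \<beta> k)) has_field_derivative 0) (at 0)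
      \<longleftrightarrow> ((\<Sum>i=1..m. \<alpha> i * L u i) + \<beta> * L u 0) - ?U * (((\<Sum>i=1..m. \<alpha> i * L p i) + \<beta> * L p 0) / ?s) = 0"
      using DERIV_unique by (metis (no_types, lifting))
    also have "\<dots> \<longleftrightarrow> ((\<Sum>i=1..m. \<alpha> i * L u i) + \<beta> * L u 0) * ?s = ?U * ((\<Sum>i=1..m. \<alpha> i * L p i) + \<beta> * L p 0)"
      using s by (simp add: eq_divide_eq)
    also have "\<dots> \<longleftrightarrow> (\<Sum>i=1..m. \<alpha> i * (L u i * ?s - ?U * L p i)) + \<beta> * (L u 0 * ?s - ?U * L p 0) = 0"
    proof -
      have sum: "(\<Sum>i=1..m. \<alpha> i * (L u i * ?s - ?U * L p i)) =
          (\<Sum>i=1..m. \<alpha> i * L u i) * ?s - ?U * (\<Sum>i=1..m. \<alpha> i * L p i)"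
        unfolding sum_distrib_right[of _ _ ?s] sum_distrib_left[of ?U] sum_subtractf[symmetric]
        by (intro sum.cong) (auto simp: algebra_simps)
      show ?thesis unfolding sum by (auto simp: algebra_simps)
    qed
    finally show ?thesis .
  qed
  have "(\<forall>\<alpha> \<beta>. (\<Sum>i=1..m. \<alpha> i * (L u i * ?s - ?U * L p i)) + \<beta> * (L u 0 * ?s - ?U * L p 0) = 0) \<longleftrightarrow>
    (\<forall>r\<in>{0..m}. L u r * ?s = ?U * L p r)"
  proof
    assume *: "\<forall>\<alpha> \<beta>. (\<Sum>i=1..m. \<alpha> i * (L u i * ?s - ?U * L p i)) + \<beta> * (L u 0 * ?s - ?U * L p 0) = 0"
    show "\<forall>r\<in>{0..m}. L u r * ?s = ?U * L p r"
    proof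
      fix r assume r: "r \<in> {0..m}"
      show "L u r * ?s = ?U * L p r"
      proof (cases "r = 0")
        case True
        then show ?thesis using *[rule_format, of "\<lambda>_. 0" 1] by simp
      next
        case False
        have "(\<Sum>i=1..m. (if i = r then 1 else 0) * (L u i * ?s - ?U * L p i)) =
            (\<Sum>i=1..m. if i = r then L u r * ?s - ?U * L p r else 0)"
          by (intro sum.cong) auto
        also have "\<dots> = L u r * ?s - ?U * L p r" using r False by simp
        finally show ?thesis using *[rule_format, of "\<lambda>i. if i = r then 1 else 0" 0] by simp
      qed
    qed
  qed simp
  moreover have "(\<forall>v\<in>cone_tangent I V p. Q v) \<longleftrightarrow> (\<forall>\<alpha> \<beta>. Q (tangent p \<alpha> \<beta>))" for Q
    unfolding cone_tangent_torus[OF p] by blast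
  ultimately show ?thesis by (simp only: iff)
qed

lemma L_scale: "L (\<lambda>k. a * p k) r = a * L p r"
  by (simp add: L_def sum_distrib_left case_prod_unfold mult.left_commute)

lemma critical_points_iff:
  "P \<in> critical_points I V u \<longleftrightarrow> (\<exists>p\<in>torus. (\<Sum>k\<in>I. p k) \<noteq> 0 \<and> P = proj_class p \<and>
     (\<forall>r\<in>{0..m}. L u r * (\<Sum>k\<in>I. p k) = (\<Sum>k\<in>I. u k) * L p r))" (is "?lhs \<longleftrightarrow> ?rhs")
proof
  assume ?lhs
  then have P: "P \<in> smooth_points I V - hyperplanes I"
    "\<And>p. p \<in> P \<Longrightarrow> \<forall>v\<in>cone_tangent I V p.
     ((\<lambda>t. likelihood_at I u p (\<lambda>k. p k + t * v k)) has_field_derivative 0) (at 0)"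
    by (auto simp: critical_points_def)
  from P(1) obtain p where p: "p \<in> torus" "(\<Sum>k\<in>I. p k) \<noteq> 0" "P = proj_class p"
    using smooth_off_hyperplanes by blast
  then have "p \<in> P" using proj_class_self by blast
  then show ?rhs using P(2) critical_at_torus[OF p(1,2)] p by blast
next
  assume ?rhs
  then obtain p where p: "p \<in> torus" "(\<Sum>k\<in>I. p k) \<noteq> 0" "P = proj_class p"
    "\<forall>r\<in>{0..m}. L u r * (\<Sum>k\<in>I. p k) = (\<Sum>k\<in>I. u k) * L p r" by blast
  have "\<forall>v\<in>cone_tangent I V q.
     ((\<lambda>t. likelihood_at I u q (\<lambda>k. q k + t * v k)) has_field_derivative 0) (at 0)" if "q \<in> P" for q
  proof -
    have "\<exists>a. a \<noteq> 0 \<and> q = (\<lambda>k. a * p k)" using that by (simp only: p(3) proj_class_iff)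
    then obtain a where a: "a \<noteq> 0" "q = (\<lambda>k. a * p k)" by (elim exE conjE)
    have "(\<Sum>k\<in>I. q k) = a * (\<Sum>k\<in>I. p k)" unfolding a(2) by (rule sum_distrib_left[symmetric])
    moreover have "q \<in> torus" using proj_class_torus[OF p(1)] that p(3) by blast
    ultimately show ?thesis
      using p(2,4) a critical_at_torus[of q u] by (simp add: L_scale mult.left_commute)
  qed
  then show ?lhs
    using smooth_off_hyperplanes[of P] p(1-3) unfolding critical_points_def by blast
qed

lemma bij_critical_points:
  assumes y: "roots.admissible (L u)"
  shows "bij_betw (\<lambda>t. proj_class (pt (\<lambda>i. L u i / poly (g i) t) t))
    {t. poly (roots.h (L u)) t = 0} (critical_points I V u)"
proof (rule bij_betw_imageI)
  define U where "U = (\<Sum>k\<in>I. u k)"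
  have U: "U \<noteq> 0" using y by (simp add: U_def sum_u roots.admissible_def)
  have Lnz: "L u i \<noteq> 0" if "i \<in> {1..m}" for i using y that by (auto simp: roots.admissible_def)
  let ?l = "\<lambda>t i. L u i / poly (g i) t"
  have root: "t \<noteq> 0" "\<And>i. i \<in> {1..m} \<Longrightarrow> poly (g i) t \<noteq> 0"
      "L u 0 = (\<Sum>i=1..m. ?l t i * (t * poly (pderiv (g i)) t))"
    if "poly (roots.h (L u)) t = 0" for t
    using that unfolding roots.critical_equation_iff[OF y, of t, symmetric] by auto
  have torus: "pt (?l t) t \<in> torus" if "poly (roots.h (L u)) t = 0" for t
    using root[OF that] Lnz by (intro torusI) auto
  show "inj_on (\<lambda>t. proj_class (pt (?l t) t)) {t. poly (roots.h (L u)) t = 0}"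
  proof (rule inj_onI)
    fix t t' assume t: "t \<in> {t. poly (roots.h (L u)) t = 0}" "t' \<in> {t. poly (roots.h (L u)) t = 0}"
      "proj_class (pt (?l t) t) = proj_class (pt (?l t') t')"
    then have "pt (?l t) t \<in> proj_class (pt (?l t') t')" using proj_class_self by metis
    then obtain a where a: "a \<noteq> 0" "pt (?l t) t = (\<lambda>k. a * pt (?l t') t' k)" unfolding proj_class_iff by blast
    \<comment> \<open>Comparing the columns \<open>(m, 0)\<close> and \<open>(m, 1)\<close>
      eliminates the scaling \<open>a\<close> and recovers \<open>t\<close>.\<close>
    have "c m 0 * ?l t m = c m 0 * (a * ?l t' m)"
      using fun_cong[OF a(2), of "(m, 0)"] I0 by (simp add: pt_apply mult.left_commute)
    then have "?l t m = a * ?l t' m" using c_I[OF I0(2)] by (metis mult_left_cancel)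
    moreover have "c m 1 * ?l t m * t = a * (c m 1 * ?l t' m * t')"
      using fun_cong[OF a(2), of "(m, 1)"] I0 by (simp add: pt_apply)
    ultimately have "(c m 1 * ?l t m) * t = (c m 1 * ?l t m) * t'" by (simp add: mult_ac)
    moreover have "c m 1 * ?l t m \<noteq> 0"
      using c_I[OF I0(3)] Lnz[of m] root(2)[of t m] t(1) m by auto
    ultimately show "t = t'" by (metis mult_left_cancel)
  qed
  show "(\<lambda>t. proj_class (pt (?l t) t)) ` {t. poly (roots.h (L u)) t = 0} = critical_points I V u"
  proof (intro equalityI subsetI)
    fix P assume "P \<in> (\<lambda>t. proj_class (pt (?l t) t)) ` {t. poly (roots.h (L u)) t = 0}"
    then obtain t where t: "poly (roots.h (L u)) t = 0" "P = proj_class (pt (?l t) t)" by blast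
    \<comment> \<open>This representative is scaled so that its statistics equal those of
      \<open>u\<close>; in particular its coordinate sum is \<open>U\<close>.\<close>
    have Li: "L (pt (?l t) t) i = L u i" if "i \<in> {1..m}" for i
      using root(2)[OF t(1) that] by (simp add: L_pt[OF that])
    have L0: "L (pt (?l t) t) 0 = L u 0" unfolding L_pt_0 using root(3)[OF t(1)] by simp
    have sum: "(\<Sum>k\<in>I. pt (?l t) t k) = U" unfolding U_def sum_u using Li by (intro sum.cong) auto
    have "L (pt (?l t) t) r = L u r" if "r \<in> {0..m}" for r
      using Li[of r] L0 that by (cases "r = 0") auto
    then show "P \<in> critical_points I V u"
      unfolding critical_points_iff using torus[OF t(1)] t(2) sum U
      by (intro bexI[of _ "pt (?l t) t"]) (auto simp: U_def)
  next
    fix P assume "P \<in> critical_points I V u"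
    then obtain p where p: "p \<in> torus" "(\<Sum>k\<in>I. p k) \<noteq> 0" "P = proj_class p"
      "\<And>r. r \<in> {0..m} \<Longrightarrow> L u r * (\<Sum>k\<in>I. p k) = U * L p r"
      unfolding critical_points_iff U_def by blast
    obtain l t where lt: "p = pt l t" "t \<noteq> 0" "\<forall>i\<in>{1..m}. l i \<noteq> 0" using p(1) by (auto simp: torus_def)
    define s where "s = (\<Sum>k\<in>I. p k)"
    have s: "s \<noteq> 0" using p(2) by (simp add: s_def)
    have row: "L u i * s = U * (l i * poly (g i) t)" if "i \<in> {1..m}" for i
      using p(4)[of i] L_pt[OF that] that by (simp add: s_def lt(1))
    \<comment> \<open>The left side of \<open>row\<close> is nonzero, so a critical point forces
      \<open>t\<close> off the roots of all \<open>g i\<close>.\<close>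
    then have gnz: "poly (g i) t \<noteq> 0" if "i \<in> {1..m}" for i
      using row[OF that] Lnz[OF that] s by auto
    have l: "l i = (s / U) * ?l t i" if "i \<in> {1..m}" for i
      using row[OF that] gnz[OF that] U by (simp add: field_simps)
    have "L u 0 * s = U * (\<Sum>i=1..m. l i * (t * poly (pderiv (g i)) t))"
      using p(4)[of 0] L_pt_0[of l t] by (simp add: s_def lt(1))
    also have "\<dots> = (\<Sum>i=1..m. ?l t i * (t * poly (pderiv (g i)) t)) * s"
      unfolding sum_distrib_left sum_distrib_right using l U by (intro sum.cong) auto
    finally have "L u 0 = (\<Sum>i=1..m. L u i * (t * poly (pderiv (g i)) t / poly (g i) t))"
      using s by simp
    then have t: "poly (roots.h (L u)) t = 0"
      using roots.critical_equation_iff[OF y, of t] lt(2) gnz by blast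
    have "p = pt (\<lambda>i. (s / U) * ?l t i) t"
      unfolding lt(1) using l by (auto simp: pt_def fun_eq_iff I_iff)
    also have "\<dots> = (\<lambda>k. (s / U) * pt (?l t) t k)" by (rule scale_pt[symmetric])
    finally have "P = proj_class (pt (?l t) t)"
      using proj_class_scale[of "s / U" "pt (?l t) t"] s U p(3) by simp
    then show "P \<in> (\<lambda>t. proj_class (pt (?l t) t)) ` {t. poly (roots.h (L u)) t = 0}" using t by blast
  qed
qed

lemma L_surj:
  assumes "y \<in> cspace {0..m}"
  shows "\<exists>u\<in>cspace I. L u = y"
proof -
  \<comment> \<open>Column \<open>(i, 0)\<close> has weight 0 in \<open>L u 0\<close> and carries
    \<open>y i\<close>; column \<open>(m, 1)\<close> has weight 1 and carries \<open>y 0\<close>,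
    which is subtracted again at \<open>(m, 0)\<close> to preserve the block sum.\<close>
  define u where "u = (\<lambda>(i, j). if (i, j) \<in> I \<and> j = 0 then y i - (if i = m then y 0 else 0)
    else if (i, j) = (m, 1) then y 0 else 0)"
  have "u \<in> cspace I" using I0 by (auto simp: u_def cspace_def)
  moreover have "L u r = y r" for r
  proof -
    consider "r = 0" | "r \<in> {1..m}" | "r > m" by fastforce
    then show ?thesis
    proof cases
      case 1
      have "(\<Sum>(i, j)\<in>I. of_nat j * u (i, j)) = (\<Sum>k\<in>I. if k = (m, 1) then y 0 else 0)"
        by (intro sum.cong) (auto simp: u_def split: if_splits)
      then show ?thesis using 1 I0 finite_I by (simp add: L_def)
    next
      case 2
      have "(\<Sum>j\<le>n r. u (r, j)) = (\<Sum>j\<le>n r. (if j = 0 then y r - (if r = m then y 0 else 0) else 0) +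
          (if j = 1 then if r = m then y 0 else 0 else 0))"
        using 2 by (intro sum.cong) (auto simp: u_def I_iff)
      also have "\<dots> = y r"
        unfolding sum.distrib using n[of r] 2 by (simp add: sum.delta)
      finally show ?thesis using 2 by (simp add: L_def)
    next
      case 3
      then show ?thesis using assms by (auto simp: L_def cspace_def)
    qed
  qed
  ultimately show ?thesis by blast
qed

lemma generic_L_admissible: "for_generic I (\<lambda>u. roots.admissible (L u))"
proof (rule for_generic_pullback[OF _ roots.generic_admissible _ _ L_surj])
  show "(\<lambda>u. L u r) \<in> polyfun I" if "r \<in> {0..m}" for r
  proof (cases "r = 0")
    case True
    then show ?thesis
      unfolding L_def case_prod_unfold by simp (intro polyfun_intros, simp)
  next
    case False
    then have "(\<lambda>u. L u r) = (\<lambda>u. \<Sum>j\<le>n r. u (r, j))" using that by (auto simp: L_def)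
    moreover have "(\<lambda>u. \<Sum>j\<le>n r. u (r, j)) \<in> polyfun I"
      using that False by (intro polyfun_intros) (auto simp: I_iff)
    ultimately show ?thesis by simp
  qed
  show "L u \<in> cspace {0..m}" for u by (auto simp: L_def cspace_def)
qed simp_all

lemma ml_degree_scroll: "ml_degree I V = card {z. \<exists>i\<in>{1..m}. poly (g i) z = 0}"
proof (rule ml_degreeI[OF finite_I], rule for_generic_mono[OF generic_L_admissible])
  fix u assume u: "roots.admissible (L u)"
  have "finite {t. poly (roots.h (L u)) t = 0}" "card {t. poly (roots.h (L u)) t = 0} = card roots.R"
  proof -
    \<comment> \<open>An infinite set has \<open>card\<close> 0, so a positive cardinality also
      yields finiteness.\<close>
    have "card {t. poly (roots.h (L u)) t = 0} = card roots.R" "card roots.R \<ge> 1"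
      using u roots.card_R by (auto simp: roots.admissible_def)
    then show "finite {t. poly (roots.h (L u)) t = 0}" "card {t. poly (roots.h (L u)) t = 0} = card roots.R"
      by (auto intro: card_ge_0_finite)
  qed
  then show "finite (critical_points I V u) \<and>
      card (critical_points I V u) = card {z. \<exists>i\<in>{1..m}. poly (g i) z = 0}"
    using bij_betw_finite[OF bij_critical_points[OF u]] bij_betw_same_card[OF bij_critical_points[OF u]]
    by (simp add: roots.R_def)
qed

end

theorem theorem17:
  fixes d :: nat and n :: "nat \<Rightarrow> nat" and c :: "nat \<Rightarrow> nat \<Rightarrow> complex"
  assumes "d \<ge> 2"
    and "\<And>i. 1 \<le> i \<Longrightarrow> i \<le> d - 1 \<Longrightarrow> n i > 0"
    and "\<And>i j. 1 \<le> i \<Longrightarrow> i \<le> d - 1 \<Longrightarrow> j \<le> n i \<Longrightarrow> c i j \<noteq> 0"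
  shows "ml_degree (scroll_columns d n) (rational_normal_scroll d n c)
           = card {z::complex. poly (\<Prod>i=1..d-1. scroll_poly n c i) z = 0}"
proof -
  interpret scroll "d - 1" n c using assms by unfold_locales auto
  have "Suc (d - 1) = d" using assms(1) by simp
  then show ?thesis using ml_degree_scroll by (simp add: poly_prod prod_zero_iff)
qed

end
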